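(* Let $n>2$ be an integer. For any two-dimensional linear subspace $H\subset\mathbb{R}^n$ the following inequality holds: $$\operatorname{Area}([-1,1]^n\cap H)\le 4\sqrt{\left\lceil\frac n2\right\rceil\left\lfloor\frac n2\right\rfloor}.$$ This bound is optimal and is attained if and only if $[-1,1]^n\cap H$ is a rectangle with the sides of lengths $2\sqrt{\lceil n/2\rceil}$ and $2\sqrt{\lfloor n/2\rfloor}$.
   Context: $\operatorname{Area}$ denotes the two-dimensional volume in $H$. "Optimal" means that equality holds for some two-dimensional linear subspace $H$ of $\mathbb{R}^n$. *)

theory Defs
  imports "HOL-Analysis.Analysis"
begin

definition cube :: "(real ^ 'n) set" where
  "cube = {x. \<forall>i. -1 \<le> x $ i \<and> x $ i \<le> 1}"

definition is_plane :: "(real ^ 'n) set \<Rightarrow> bool" where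
  "is_plane H \<longleftrightarrow> subspace H \<and> dim H = 2"

definition plane_chart :: "(real ^ 'n) set \<Rightarrow> (real ^ 2 \<Rightarrow> real ^ 'n) \<Rightarrow> bool" where
  "plane_chart H f \<longleftrightarrow> linear f \<and> (\<forall>x. norm (f x) = norm x) \<and> range f = H"

text \<open>The library has no Hausdorff measure. The two-dimensional volume in a plane \<open>H\<close> is the
  Lebesgue measure of the set read in Euclidean coordinates on \<open>H\<close>, i.e. along a linear
  isometry from \<open>real ^ 2\<close> onto \<open>H\<close>. Such a chart exists, and the area of a compact set
  does not depend on it: see \<open>plane_chart_exists\<close> and \<open>area_eq\<close>.\<close>

definition area :: "(real ^ 'n) set \<Rightarrow> (real ^ 'n) set \<Rightarrow> real" where
  "area H S = measure lebesgue ((SOME f. plane_chart H f) -` S)"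

text \<open>The vertices are \<open>p\<close>, \<open>p + v\<close>, \<open>p + v + w\<close>, \<open>p + w\<close>.\<close>

definition is_rectangle :: "(real ^ 'n) set \<Rightarrow> real \<Rightarrow> real \<Rightarrow> bool" where
  "is_rectangle S a b \<longleftrightarrow>
     (\<exists>p v w. orthogonal v w \<and> norm v = a \<and> norm w = b \<and>
       S = convex hull {p, p + v, p + v + w, p + w})"

lemma plane_chart_exists:
  fixes H :: "(real ^ 'n) set"
  assumes "is_plane H"
  shows "\<exists>f. plane_chart H f"
proof -
  have "dim (UNIV :: (real ^ 2) set) = dim H"
    using assms by (simp add: is_plane_def)
  then obtain f :: "real ^ 2 \<Rightarrow> real ^ 'n"
    where "linear f" "f ` UNIV = H" "\<And>x. x \<in> UNIV \<Longrightarrow> norm (f x) = norm x"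
    using isometry_subspaces[of "UNIV :: (real ^ 2) set" H] assms
    by (auto simp: is_plane_def)
  then show ?thesis by (auto simp: plane_chart_def)
qed

lemma plane_chart_inj:
  assumes "plane_chart H f"
  shows "inj f"
  using assms unfolding plane_chart_def
  by (metis linear_injective_0 norm_eq_zero)

lemma plane_chart_vimage_compact:
  assumes f: "plane_chart H f" and S: "compact S"
  shows "compact (f -` S)"
proof -
  have lin: "linear f" and nrm: "\<And>x. norm (f x) = norm x"
    using f by (auto simp: plane_chart_def)
  have "continuous_on UNIV f"
    using lin linear_continuous_on linear_conv_bounded_linear by blast
  then have "closed (f -` S)"
    using S by (simp add: compact_imp_closed closed_vimage)
  moreover have "bounded (f -` S)"
    using compact_imp_bounded[OF S] nrm unfolding bounded_iff by (metis vimageE)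
  ultimately show ?thesis by (simp add: compact_eq_bounded_closed)
qed

lemma plane_chart_measure_unique:
  assumes f: "plane_chart H f" and g: "plane_chart H g" and S: "compact S"
  shows "measure lebesgue (f -` S) = measure lebesgue (g -` S)"
proof -
  define q where "q = inv g \<circ> f"
  have injg: "inj g" and linf: "linear f" and ling: "linear g"
    and nf: "\<And>x. norm (f x) = norm x" and ng: "\<And>x. norm (g x) = norm x"
    and rf: "range f = H" and rg: "range g = H"
    using f g plane_chart_inj by (auto simp: plane_chart_def)
  have gq: "g (q x) = f x" for x
    unfolding q_def using rf rg by (metis comp_apply f_inv_into_f rangeI)
  have linq: "linear q"
  proof (rule linearI)
    show "q (x + y) = q x + q y" for x y
      by (rule injD[OF injg]) (simp add: gq linear_add[OF linf] linear_add[OF ling])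
    show "q (c *\<^sub>R x) = c *\<^sub>R q x" for c x
      by (rule injD[OF injg]) (simp add: gq linear_scale[OF linf] linear_scale[OF ling])
  qed
  have nq: "norm (q x) = norm x" for x
    using gq nf ng by metis
  have ot: "orthogonal_transformation q"
    using linq nq by (simp add: orthogonal_transformation)
  have im: "q ` (f -` S) = g -` S"
  proof
    show "q ` (f -` S) \<subseteq> g -` S" by (auto simp: gq)
    show "g -` S \<subseteq> q ` (f -` S)"
    proof
      fix y assume y: "y \<in> g -` S"
      obtain x where "f x = g y" using rf rg by (metis rangeE rangeI)
      then have "q x = y" using injg gq by (metis injD)
      then show "y \<in> q ` (f -` S)" using y \<open>f x = g y\<close> by auto
    qed
  qed
  have "f -` S \<in> lmeasurable"
    using plane_chart_vimage_compact[OF f S] by (rule lmeasurable_compact)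
  then have "measure lebesgue (q ` (f -` S)) = \<bar>det (matrix q)\<bar> * measure lebesgue (f -` S)"
    by (rule measure_linear_image[OF linq])
  also have "\<bar>det (matrix q)\<bar> = 1"
    using ot by (rule orthogonal_transformation_det)
  finally show ?thesis by (simp add: im)
qed

lemma area_eq:
  assumes f: "plane_chart H f" and S: "compact S"
  shows "area H S = measure lebesgue (f -` S)"
  unfolding area_def
  using plane_chart_measure_unique[OF someI[of "plane_chart H", OF f] f S] .

end

theory Submission
  imports Defs
begin

text \<open>
  Along an isometric chart \<open>f\<close> of the plane, the section becomes the symmetric convex set
  \<open>P = {x. \<forall>i. \<bar>x \<bullet> u i\<bar> \<le> 1}\<close> in \<open>real ^ 2\<close>, where the \<open>u i\<close> are the projections of the standard
  basis vectors to the plane. They form a tight frame: \<open>\<Sum>i. (x \<bullet> u i) * (y \<bullet> u i) = x \<bullet> y\<close>. By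
  Lagrange's identity the squared cross products \<open>u i \<times> u j\<close> over unordered pairs then add up
  to \<open>1\<close>. With \<open>A\<close> the area of \<open>P\<close> and \<open>y i j = (A / 4 * (u i \<times> u j))\<^sup>2\<close>, the bound on the area is the
  inequality \<open>\<Sum>i<j. y i j \<le> n\<^sup>2 div 4\<close>. Since \<open>A * \<bar>u i \<times> u j\<bar> / 4\<close> is the fraction of the
  parallelogram of the strips \<open>i\<close> and \<open>j\<close> that is filled by \<open>P\<close>, every \<open>y i j\<close> is at most \<open>1\<close>.

  This is Mantel's theorem (a triangle-free graph on \<open>n\<close> vertices has at most \<open>n\<^sup>2 div 4\<close> edges)
  with weights, and it is proved like Mantel's theorem, by removing vertices
  (\<open>weighted_Mantel\<close>). An edge of a triangle-free graph can be removed because its ends have no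
  common neighbour; here a pair \<open>i, j\<close> can be removed if \<open>y i k + y j k \<le> 1\<close> for all other \<open>k\<close>.
  Take the pair with the largest cross product. If some \<open>k\<close> violates the condition, the third
  strip cuts two opposite corners off the parallelogram of the first two
  (\<open>area_three_strips_le\<close>), so that \<open>A\<close> is noticeably smaller than that parallelogram. A
  quantitative form of this (\<open>failing_pair_bounds\<close>) shows that the three
  vectors together can be removed instead, because \<open>y i l + y j l + y k l \<le> 3/2\<close> for all
  other \<open>l\<close> (\<open>strips_removable\<close>).

  Removing a triple always loses something, so equality forces a removable pair with \<open>y i j = 1\<close>
  and \<open>y i k + y j k = 1\<close> for all other \<open>k\<close>. Then \<open>P\<close> fills the parallelogram of the strips \<open>i\<close> and
  \<open>j\<close>, no other strip may cut a corner, and every other vector is \<open>\<plusminus>u i\<close> or \<open>\<plusminus>u j\<close>. The tight frame condition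
  makes \<open>u i\<close> and \<open>u j\<close> orthogonal of lengths \<open>1 / sqrt k\<close> and \<open>1 / sqrt l\<close>, where \<open>k\<close> and \<open>l\<close> are the
  multiplicities, and \<open>k * l = n\<^sup>2 div 4\<close> shows that these are the two halves of \<open>n\<close>
  (\<open>frame_section_equality\<close>). Such a rectangle is
  realised by the plane of the vectors that are constant on a block of \<open>k\<close> coordinates and on its
  complement (\<open>block_plane\<close>).
\<close>

section \<open>A weighted version of Mantel's theorem\<close>

definition removable_pair :: "('i \<Rightarrow> 'i \<Rightarrow> real) \<Rightarrow> 'i set \<Rightarrow> bool" where
  "removable_pair y T \<longleftrightarrow>
     (\<exists>i\<in>T. \<exists>j\<in>T. i \<noteq> j \<and> y i j \<le> 1 \<and> (\<forall>k\<in>T - {i, j}. y i k + y j k \<le> 1))"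

text \<open>
  The thresholds make the removal of a triple affordable: from \<open>m\<close> to \<open>m + 3\<close> indices,
  \<open>n\<^sup>2 div 4\<close> grows by at least \<open>3/2 * m + 2\<close> (see \<open>div4_step3\<close>). The inequality \<open>< 2\<close> is
  strict, so that a triple is never removed in a case of equality.
\<close>

definition removable_triple :: "('i \<Rightarrow> 'i \<Rightarrow> real) \<Rightarrow> 'i set \<Rightarrow> bool" where
  "removable_triple y T \<longleftrightarrow>
     (\<exists>i\<in>T. \<exists>j\<in>T. \<exists>k\<in>T. i \<noteq> j \<and> i \<noteq> k \<and> j \<noteq> k \<and> y i j + y i k + y j k < 2 \<and>
        (\<forall>l\<in>T - {i, j, k}. y i l + y j l + y k l \<le> 3/2))"

lemma double_sum_remove:
  fixes y :: "'i \<Rightarrow> 'i \<Rightarrow> real"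
  assumes fin: "finite T" and R: "R \<subseteq> T" and sym: "\<And>i j. y i j = y j i"
  shows "(\<Sum>i\<in>T. \<Sum>j\<in>T. y i j) =
    (\<Sum>i\<in>T-R. \<Sum>j\<in>T-R. y i j) + (\<Sum>i\<in>R. \<Sum>j\<in>R. y i j) + 2 * (\<Sum>k\<in>T-R. \<Sum>r\<in>R. y r k)"
proof -
  have split: "sum g T = sum g (T - R) + sum g R" for g :: "'i \<Rightarrow> real"
    using sum.subset_diff[OF R fin] by simp
  have "(\<Sum>i\<in>R. \<Sum>j\<in>T-R. y i j) = (\<Sum>k\<in>T-R. \<Sum>r\<in>R. y r k)"
    by (rule sum.swap)
  moreover have "(\<Sum>i\<in>T-R. \<Sum>j\<in>R. y i j) = (\<Sum>k\<in>T-R. \<Sum>r\<in>R. y r k)"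
    by (simp add: sym)
  ultimately show ?thesis
    by (simp add: split sum.distrib)
qed

lemma div4_step2: "((m::nat) + 2)^2 div 4 = m^2 div 4 + m + 1"
proof -
  have "(m + 2)^2 = m^2 + (m + 1) * 4" by (simp add: power2_eq_square algebra_simps)
  then show ?thesis by simp
qed

lemma div4_step3: "2 * ((m::nat)^2 div 4) + 3 * m + 4 \<le> 2 * ((m + 3)^2 div 4)"
proof (cases "even m")
  case True
  then obtain k where m: "m = 2 * k" by (elim evenE)
  have "m^2 = 4 * k^2" "(m + 3)^2 = 1 + (k^2 + 3*k + 2) * 4"
    by (simp_all add: m power2_eq_square algebra_simps)
  then have "m^2 div 4 = k^2" "(m + 3)^2 div 4 = k^2 + 3*k + 2" by simp_all
  then show ?thesis using m by simp
next
  case False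
  then obtain k where m: "m = 2 * k + 1" by (elim oddE)
  have "m^2 = 1 + (k^2 + k) * 4" "(m + 3)^2 = 4 * (k^2 + 4*k + 4)"
    by (simp_all add: m power2_eq_square algebra_simps)
  then have "m^2 div 4 = k^2 + k" "(m + 3)^2 div 4 = k^2 + 4*k + 4" by simp_all
  then show ?thesis using m by simp
qed

text \<open>
  Induction on the number of indices. Each step removes a pair or a triple whose contribution is
  at most the growth of \<open>n\<^sup>2 div 4\<close>; for a triple it is strictly smaller. Hence a case of equality
  starts with a pair for which all the inequalities in \<open>removable_pair\<close> are equalities. The sums run
  over ordered pairs, which doubles the bound.
\<close>

lemma weighted_Mantel:
  fixes y :: "'i \<Rightarrow> 'i \<Rightarrow> real"
  assumes fin: "finite S" and sym: "\<And>i j. y i j = y j i" and diag: "\<And>i. y i i = 0"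
    and red: "\<And>T. T \<subseteq> S \<Longrightarrow> 2 \<le> card T \<Longrightarrow> removable_pair y T \<or> removable_triple y T"
  shows "(\<Sum>i\<in>S. \<Sum>j\<in>S. y i j) \<le> 2 * real ((card S)^2 div 4) \<and>
    (2 \<le> card S \<longrightarrow> (\<Sum>i\<in>S. \<Sum>j\<in>S. y i j) = 2 * real ((card S)^2 div 4) \<longrightarrow>
      (\<exists>i\<in>S. \<exists>j\<in>S. i \<noteq> j \<and> y i j = 1 \<and> (\<forall>k\<in>S - {i, j}. y i k + y j k = 1)))"
  using fin red
proof (induction "card S" arbitrary: S rule: less_induct)
  case less
  note fin = less.prems(1)
  show ?case
  proof (cases "2 \<le> card S")
    case False
    then have "card S = 0 \<or> card S = 1" by auto
    then have "(\<Sum>i\<in>S. \<Sum>j\<in>S. y i j) = 0"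
      using fin diag by (auto simp: card_1_singleton_iff)
    then show ?thesis using False by simp
  next
    case True
    have IH: "(\<Sum>i\<in>S-R. \<Sum>j\<in>S-R. y i j) \<le> 2 * real ((card (S-R))^2 div 4)"
      if "R \<subseteq> S" "R \<noteq> {}" for R
    proof -
      have "S - R \<subset> S" using that by auto
      then have "card (S - R) < card S" using fin by (rule psubset_card_mono[rotated])
      moreover have "\<And>T. T \<subseteq> S - R \<Longrightarrow> 2 \<le> card T \<Longrightarrow> removable_pair y T \<or> removable_triple y T"
        using less.prems(2) by blast
      ultimately show ?thesis using less.hyps[of "S - R"] fin by blast
    qed
    consider "removable_pair y S" | "removable_triple y S"
      using less.prems(2)[OF order_refl True] by blast
    then show ?thesis
    proof cases
      case 1
      then obtain i j where ij: "i \<in> S" "j \<in> S" "i \<noteq> j" "y i j \<le> 1"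
        and k: "\<And>k. k \<in> S - {i, j} \<Longrightarrow> y i k + y j k \<le> 1"
        unfolding removable_pair_def by blast
      define m where "m = card (S - {i, j})"
      have cS: "card S = m + 2"
        using ij fin True by (simp add: m_def card_Diff_subset)
      have eq: "(\<Sum>i\<in>S. \<Sum>j\<in>S. y i j) = (\<Sum>k\<in>S-{i,j}. \<Sum>l\<in>S-{i,j}. y k l) + 2 * y i j
          + 2 * (\<Sum>k\<in>S-{i,j}. y i k + y j k)"
        using double_sum_remove[OF fin, of "{i, j}" y] ij sym diag sym[of j i] by simp
      have s: "(\<Sum>k\<in>S-{i,j}. y i k + y j k) \<le> real m"
        using sum_bounded_above[of "S-{i,j}" "\<lambda>k. y i k + y j k" 1] k by (simp add: m_def)
      have r: "(\<Sum>k\<in>S-{i,j}. \<Sum>l\<in>S-{i,j}. y k l) \<le> 2 * real (m^2 div 4)"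
        using IH[of "{i, j}"] ij by (simp add: m_def)
      have g: "2 * real ((card S)^2 div 4) = 2 * real (m^2 div 4) + 2 * real m + 2"
        by (simp only: cS div4_step2) simp
      have "\<exists>i\<in>S. \<exists>j\<in>S. i \<noteq> j \<and> y i j = 1 \<and> (\<forall>k\<in>S - {i, j}. y i k + y j k = 1)"
        if e: "(\<Sum>i\<in>S. \<Sum>j\<in>S. y i j) = 2 * real ((card S)^2 div 4)"
      proof -
        have "y i j = 1" and t: "(\<Sum>k\<in>S-{i,j}. y i k + y j k) = real m"
          using e eq g s r ij(4) by linarith+
        have "(\<Sum>k\<in>S-{i,j}. 1 - (y i k + y j k)) = 0"
          using t by (simp add: sum_subtractf m_def)
        then have "\<forall>k\<in>S-{i,j}. 1 - (y i k + y j k) = 0"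
          using fin k by (subst (asm) sum_nonneg_eq_0_iff) auto
        then have "\<forall>k\<in>S-{i,j}. y i k + y j k = 1" by simp
        then show ?thesis using \<open>y i j = 1\<close> ij by blast
      qed
      then show ?thesis using eq g s r ij(4) by auto
    next
      case 2
      then obtain i j k where ijk: "i \<in> S" "j \<in> S" "k \<in> S" "i \<noteq> j" "i \<noteq> k" "j \<noteq> k"
        and t: "y i j + y i k + y j k < 2"
        and l: "\<And>l. l \<in> S - {i, j, k} \<Longrightarrow> y i l + y j l + y k l \<le> 3/2"
        unfolding removable_triple_def by blast
      define m where "m = card (S - {i, j, k})"
      have "card {i, j, k} = 3" using ijk by simp
      then have "3 \<le> card S" using ijk fin card_mono[of S "{i, j, k}"] by simp
      then have cS: "card S = m + 3"
        using ijk fin by (simp add: m_def card_Diff_subset)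
      have eq: "(\<Sum>i\<in>S. \<Sum>j\<in>S. y i j) = (\<Sum>l\<in>S-{i,j,k}. \<Sum>l'\<in>S-{i,j,k}. y l l')
          + 2 * (y i j + y i k + y j k) + 2 * (\<Sum>l\<in>S-{i,j,k}. y i l + y j l + y k l)"
        using double_sum_remove[OF fin, of "{i, j, k}" y] ijk sym diag sym[of j i] sym[of k i] sym[of k j]
        by (simp add: algebra_simps)
      have s: "(\<Sum>l\<in>S-{i,j,k}. y i l + y j l + y k l) \<le> real m * (3/2)"
        using sum_bounded_above[of "S-{i,j,k}" "\<lambda>l. y i l + y j l + y k l" "3/2"] l
        by (simp add: m_def)
      have r: "(\<Sum>l\<in>S-{i,j,k}. \<Sum>l'\<in>S-{i,j,k}. y l l') \<le> 2 * real (m^2 div 4)"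
        using IH[of "{i, j, k}"] ijk by (simp add: m_def)
      have "real (2 * (m^2 div 4) + 3 * m + 4) \<le> real (2 * ((m + 3)^2 div 4))"
        using div4_step3 by (rule of_nat_mono)
      then have "2 * real (m^2 div 4) + 3 * real m + 4 \<le> 2 * real ((card S)^2 div 4)"
        unfolding cS by simp
      then have "(\<Sum>i\<in>S. \<Sum>j\<in>S. y i j) < 2 * real ((card S)^2 div 4)"
        using eq s r t by argo
      then show ?thesis by auto
    qed
  qed
qed

section \<open>Numerical estimates for a corner cut off a square\<close>

text \<open>
  Here \<open>x\<close> stands for the filled fraction of the parallelogram of a pair with largest cross
  product, and \<open>z1, z2\<close> are the absolute values of the coordinates of a third vector with respect
  to that pair, so that \<open>x\<^sup>2 * z1\<^sup>2\<close> and \<open>x\<^sup>2 * z2\<^sup>2\<close> are the weights between the third vector and the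
  pair. With
  \<open>d = z1 + z2 - 1\<close> and \<open>e = (1 - z1) * (1 - z2)\<close> one has \<open>z1 * z2 = d + e\<close> and
  \<open>z1\<^sup>2 + z2\<^sup>2 = 1 + d\<^sup>2 - 2 * e\<close>, and the area estimate becomes \<open>x \<le> 1 - d/4 + e/4\<close>. If the pair
  condition fails, then \<open>d \<ge> 13/20\<close>, and for such \<open>d\<close> the sum of \<open>x\<^sup>2 * (z1\<^sup>2 + z2\<^sup>2)\<close> and
  \<open>x\<^sup>2 * (2 + (1 - d)\<^sup>2)\<close> stays below \<open>5/2\<close>. As the first summand exceeds \<open>1\<close>, the second one is
  below \<open>3/2\<close>. There is little slack near \<open>z1 = 1\<close>, \<open>z2 = 0.66\<close>,
  where the pair condition starts to fail.
\<close>

lemma failing_pair_bounds: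
  fixes x z1 z2 :: real
  assumes z: "0 \<le> z1" "z1 \<le> 1" "0 \<le> z2" "z2 \<le> 1" and x: "0 \<le> x" "x \<le> 1"
    and cut: "1 < z1 + z2 \<Longrightarrow> x \<le> 1 - (z1 + z2 - 1)^2 / (4 * z1 * z2)"
    and fail: "1 < x^2 * (z1^2 + z2^2)"
  shows "1 < z1 + z2" "x^2 * (2 + (2 - z1 - z2)^2) < 3/2" "x^2 * (1 + z1^2 + z2^2) < 2"
proof -
  show big: "1 < z1 + z2"
  proof (rule ccontr)
    assume "\<not> 1 < z1 + z2"
    then have "(z1 + z2)^2 \<le> 1" using z by (intro power_le_one) auto
    moreover have "z1^2 + z2^2 \<le> (z1 + z2)^2" using z by (simp add: power2_sum)
    moreover have "x^2 \<le> 1" using x by (intro power_le_one) auto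
    ultimately have "x^2 * (z1^2 + z2^2) \<le> 1 * 1" by (intro mult_mono) auto
    then show False using fail by simp
  qed
  define d where "d = z1 + z2 - 1"
  define e where "e = (1 - z1) * (1 - z2)"
  define X where "X = 1 - d/4 + e/4"
  have d: "0 < d" "d \<le> 1" using big z by (auto simp: d_def)
  have e0: "0 \<le> e" using z by (simp add: e_def)
  have e1: "4 * e \<le> (1 - d)^2"
    using zero_le_power2[of "z1 - z2"] by (simp add: e_def d_def power2_eq_square algebra_simps)
  have p: "z1 * z2 = d + e" by (simp add: d_def e_def algebra_simps)
  have t: "z1^2 + z2^2 = 1 + d^2 - 2 * e" by (simp add: d_def e_def power2_eq_square algebra_simps)
  \<comment> \<open>the tangent to the convex function \<open>p \<mapsto> d\<^sup>2 / (4 * p)\<close> at \<open>p = d\<close>\<close>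
  have "(d - e) / 4 \<le> d^2 / (4 * (d + e))"
    using d e0 by (simp add: field_simps power2_eq_square)
  moreover have "x \<le> 1 - d^2 / (4 * (d + e))"
    using cut[OF big] by (simp add: d_def[symmetric] p[symmetric] mult.assoc)
  ultimately have xX: "x \<le> X" by (simp add: X_def field_simps)
  have x2: "x^2 \<le> X^2" using x xX by (intro power_mono) auto
  have tpos: "0 \<le> 1 + d^2 - 2 * e" unfolding t[symmetric] by simp
  have f: "1 < X^2 * (1 + d^2 - 2 * e)"
    using fail mult_right_mono[OF x2 tpos] by (simp add: t)
  have X0: "3/4 \<le> 1 - d/4" using d by simp
  \<comment> \<open>As \<open>3/4 \<le> 1 - d/4\<close>, the factor \<open>(1 + e/3)\<^sup>2 * (1 - e) \<le> 1\<close> absorbs \<open>e\<close>, and it remains to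
    compare \<open>(1 - d/4)\<^sup>2 * (1 + d\<^sup>2)\<close> with \<open>1\<close>.\<close>
  have d_lower: "13/20 \<le> d"
  proof (rule ccontr)
    assume c: "\<not> 13/20 \<le> d"
    have "X \<le> (1 - d/4) * (1 + e/3)"
      using mult_right_mono[OF X0, of "e/3"] e0 by (simp add: X_def algebra_simps)
    moreover have "0 \<le> X" using xX x by simp
    ultimately have "X^2 \<le> ((1 - d/4) * (1 + e/3))^2" by (intro power_mono) auto
    moreover have "1 + d^2 - 2 * e \<le> (1 + d^2) * (1 - e)"
    proof -
      have "d^2 \<le> 1" using d by (intro power_le_one) auto
      then have "d^2 * e \<le> 1 * e" using e0 by (intro mult_right_mono)
      then show ?thesis by (simp add: algebra_simps)
    qed
    ultimately have "X^2 * (1 + d^2 - 2 * e) \<le> ((1 - d/4) * (1 + e/3))^2 * ((1 + d^2) * (1 - e))"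
      using tpos by (intro mult_mono) auto
    also have "\<dots> = ((1 - d/4)^2 * (1 + d^2)) * ((1 + e/3)^2 * (1 - e))"
      by (simp add: power_mult_distrib)
    also have "\<dots> \<le> 1 * 1"
    proof (intro mult_mono)
      have "d * (-1/2 + 17*d/16 - d^2/2 + d^3/16) \<le> 0"
      proof (rule mult_nonneg_nonpos)
        have "d^3 \<le> d^2 * (13/20)"
          using mult_left_mono[of d "13/20" "d^2"] c by (simp add: eval_nat_numeral)
        moreover have "0 \<le> (d - 13/20)^2" by simp
        then have "d^2 \<ge> 13/10*d - 169/400" by (simp add: power2_eq_square algebra_simps)
        ultimately show "-1/2 + 17*d/16 - d^2/2 + d^3/16 \<le> 0" using d c by linarith
      qed (use d in simp)
      moreover have "(1 - d/4)^2 * (1 + d^2) = 1 + d * (-1/2 + 17*d/16 - d^2/2 + d^3/16)"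
        by (simp add: eval_nat_numeral field_simps)
      ultimately show "(1 - d/4)^2 * (1 + d^2) \<le> 1" by simp
      have "0 \<le> e * (1/3 + 5*e/9 + e^2/9)" using e0 by simp
      moreover have "(1 + e/3)^2 * (1 - e) = 1 - e * (1/3 + 5*e/9 + e^2/9)"
        by (simp add: power2_eq_square field_simps)
      ultimately show "(1 + e/3)^2 * (1 - e) \<le> 1" by simp
      show "0 \<le> (1 + e/3)^2 * (1 - e)"
      proof -
        have "(1-d)^2 \<le> 1" using d by (intro power_le_one) auto
        then have "e \<le> 1" using e1 by simp
        then show ?thesis by simp
      qed
    qed simp
    finally show False using f by simp
  qed
  have e2: "e \<le> 49/1600"
  proof -
    have "(1 - d)^2 \<le> (7/20)^2" using d d_lower by (intro power_mono) auto
    then show ?thesis using e1 by (simp add: power2_eq_square)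
  qed
  \<comment> \<open>\<open>4 - 2 * d + 2 * d\<^sup>2 - 2 * e\<close> is \<open>(z1\<^sup>2 + z2\<^sup>2) + (2 + (1 - d)\<^sup>2)\<close>. In terms of \<open>r = 1 - d\<close>, the
    product is expanded in powers of \<open>e \<le> r\<^sup>2 / 4\<close>; the quadratic and cubic terms are negative.\<close>
  have main: "X^2 * (4 - 2*d + 2*d^2 - 2*e) < 5/2"
  proof -
    define r where "r = 1 - d"
    have r: "0 \<le> r" "r \<le> 7/20" "e \<le> r^2 / 4" using d d_lower e1 by (auto simp: r_def)
    define X0 where "X0 = 3/4 + r/4"
    define W where "W = 4 - 2*r + 2*r^2"
    have XX: "X = X0 + e/4" by (simp add: X_def X0_def r_def diff_divide_distrib)
    have WW: "4 - 2*d + 2*d^2 = W" by (simp add: W_def r_def power2_eq_square algebra_simps)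
    have b0: "3/4 \<le> X0" "X0 \<le> 84/100" unfolding X0_def using r by linarith+
    have r2: "r^2 \<le> 7/20 * r" "r^3 \<le> 49/400 * r" "r^4 \<le> 343/8000 * r"
    proof -
      have p: "r^k \<le> (7/20)^k" for k using r by (intro power_mono) auto
      show "r^2 \<le> 7/20 * r" "r^3 \<le> 49/400 * r" "r^4 \<le> 343/8000 * r"
        using mult_right_mono[OF p[of 1] r(1)] mult_right_mono[OF p[of 2] r(1)]
          mult_right_mono[OF p[of 3] r(1)] by (simp_all add: eval_nat_numeral mult_ac)
    qed
    have "(X0 + e/4)^2 * (W - 2*e)
        = X0^2 * W + e * (X0 * (W/2 - 2*X0)) - e^2 * (X0 - W/16) - e^3/8"
      by (simp add: power2_eq_square power3_eq_cube field_simps)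
    moreover have "X0^2 * W = 9/4 + 3/8 * r + 5/8 * r^2 + 5/8 * r^3 + 1/8 * r^4"
      by (simp add: X0_def W_def eval_nat_numeral field_simps)
    moreover have "e * (X0 * (W/2 - 2*X0)) \<le> 21/200 * r^2"
    proof -
      have w: "W/2 - 2*X0 = 1/2 - 3/2 * r + r^2" 
        by (simp add: W_def X0_def diff_divide_distrib add_divide_distrib)
      have "W/2 - 2*X0 \<le> 1/2" unfolding w using r r2 by linarith
      then have "X0 * (W/2 - 2*X0) \<le> X0 * (1/2)" using b0 by (intro mult_left_mono) auto
      also have "\<dots> \<le> 84/100 * (1/2)" using b0(2) by (rule mult_right_mono) simp
      finally have "X0 * (W/2 - 2*X0) \<le> 84/100 * (1/2)" .
      then have "e * (X0 * (W/2 - 2*X0)) \<le> e * (84/100 * (1/2))" using e0 by (rule mult_left_mono)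
      also have "\<dots> \<le> 21/200 * r^2" using r(3) by simp
      finally show ?thesis .
    qed
    moreover have "0 \<le> e^2 * (X0 - W/16)"
    proof -
      have "W \<le> 5" using r r2 unfolding W_def by linarith
      then have "0 \<le> X0 - W/16" using b0 by linarith
      then show ?thesis by simp
    qed
    moreover have "0 \<le> e^3" using e0 by simp
    ultimately have "(X0 + e/4)^2 * (W - 2*e) < 5/2" using r r2 by linarith
    then show ?thesis by (simp add: XX WW)
  qed
  have pos: "0 \<le> 4 - 2*d + 2*d^2 - 2*e" using d e2 zero_le_power2[of d] by linarith
  have M: "x^2 * (4 - 2*d + 2*d^2 - 2*e) < 5/2"
    using mult_right_mono[OF x2 pos] main by linarith
  show "x^2 * (2 + (2 - z1 - z2)^2) < 3/2"
  proof -
    have eq: "2 + (2 - z1 - z2)^2 = (4 - 2*d + 2*d^2 - 2*e) - (z1^2 + z2^2)"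
      by (simp add: d_def e_def power2_eq_square algebra_simps)
    have "x^2 * (2 + (2 - z1 - z2)^2) = x^2 * (4 - 2*d + 2*d^2 - 2*e) - x^2 * (z1^2 + z2^2)"
      unfolding eq by (rule right_diff_distrib)
    then show ?thesis using M fail by linarith
  qed
  show "x^2 * (1 + z1^2 + z2^2) < 2"
  proof -
    \<comment> \<open>\<open>1 + z1\<^sup>2 + z2\<^sup>2\<close> is at most \<open>4/5\<close> of the second factor in \<open>M\<close>, and \<open>4/5 * 5/2 = 2\<close>.\<close>
    have "0 \<le> 6 - 8 * d + 3 * d^2 + 2 * e"
    proof -
      have "0 \<le> 3 * (d - 4/3)^2" by simp
      also have "\<dots> = 16/3 - 8 * d + 3 * d^2" by (simp add: power2_eq_square algebra_simps)
      finally show ?thesis using e0 by linarith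
    qed
    then have "5 * (1 + z1^2 + z2^2) \<le> 4 * (4 - 2*d + 2*d^2 - 2*e)"
      using t by simp
    then have "x^2 * (5 * (1 + z1^2 + z2^2)) \<le> x^2 * (4 * (4 - 2*d + 2*d^2 - 2*e))"
      by (rule mult_left_mono) simp
    then have "5 * (x^2 * (1 + z1^2 + z2^2)) \<le> 4 * (x^2 * (4 - 2*d + 2*d^2 - 2*e))"
      by (simp only: mult.left_commute)
    also have "\<dots> < 4 * (5/2)" using M by (rule mult_strict_left_mono) simp
    finally show ?thesis by simp
  qed
qed

text \<open>
  Of the three numbers \<open>a\<close>, \<open>b\<close> and \<open>z1 * b - z2 * a\<close> in \<open>[-1, 1]\<close>, at most two can be extreme. The
  sum of squares is convex on the hexagon of admissible \<open>(a, b)\<close>, and at each of its vertices two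
  of the numbers are \<open>\<plusminus>1\<close> while the third is at most \<open>2 - z1 - z2\<close> in absolute value. For equal
  signs of \<open>a\<close> and \<open>b\<close> one replaces \<open>b\<close> by \<open>1\<close> and uses convexity in \<open>a\<close>.
\<close>

lemma third_vector_bound_same_signs:
  fixes a b z1 z2 :: real
  assumes z: "0 \<le> z1" "z1 \<le> 1" "0 \<le> z2" "z2 \<le> 1" "1 < z1 + z2"
    and ab: "0 \<le> a" "a \<le> 1" "0 \<le> b" "b \<le> 1" and pos: "0 \<le> z1 * b - z2 * a"
  shows "a^2 + b^2 + (z1 * b - z2 * a)^2 \<le> 2 + (2 - z1 - z2)^2"
proof -
  have "z1 * b - z2 * a \<le> (1 - a) * z1 + a * (z1 - z2)"
    using z ab mult_left_mono[of b 1 z1] by (simp add: algebra_simps)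
  then have "(z1 * b - z2 * a)^2 \<le> ((1 - a) * z1 + a * (z1 - z2))^2"
    using pos by (intro power_mono) auto
  also have "\<dots> = (1 - a) * z1^2 + a * (z1 - z2)^2 - a * (1 - a) * z2^2"
    by (simp add: power2_eq_square algebra_simps)
  also have "\<dots> \<le> (1 - a) * 1 + 1 * (2 - z1 - z2)^2 - 0"
  proof -
    have "(z1 - z2)^2 \<le> (2 - z1 - z2)^2"
      using z by (intro power2_le_iff_abs_le[THEN iffD2]) auto
    moreover have "z1^2 \<le> 1" using z by (intro power_le_one) auto
    ultimately show ?thesis using ab by (intro diff_mono add_mono mult_mono) auto
  qed
  finally have "(z1 * b - z2 * a)^2 \<le> 1 - a + (2 - z1 - z2)^2" by simp
  moreover have "a^2 \<le> a" "b^2 \<le> 1"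
    using ab mult_left_mono[of a 1 a] by (auto simp: power2_eq_square mult_le_one)
  ultimately show ?thesis by linarith
qed

text \<open>
  Here \<open>b\<close> has changed its sign. The constraint \<open>z1 * b + z2 * a \<le> 1\<close> keeps \<open>(a, b)\<close> away from the
  corner \<open>(1, 1)\<close> of the square: it implies \<open>a + b \<le> 3 - z1 - z2\<close>.
\<close>

lemma third_vector_bound_opposite_signs:
  fixes a b z1 z2 :: real
  assumes z: "0 \<le> z1" "z1 \<le> 1" "0 \<le> z2" "z2 \<le> 1" "1 < z1 + z2"
    and ab: "0 \<le> a" "a \<le> 1" "0 \<le> b" "b \<le> 1" and le: "z1 * b + z2 * a \<le> 1"
  shows "a^2 + b^2 + (z1 * b + z2 * a)^2 \<le> 2 + (2 - z1 - z2)^2"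
proof -
  have "0 \<le> z1 * b + z2 * a" using z ab by simp
  then have c: "(z1 * b + z2 * a)^2 \<le> 1" using le by (intro power_le_one) auto
  have s: "a + b \<le> 1 + (2 - z1 - z2)"
    using le mult_left_mono[of b 1 "1 - z1"] mult_left_mono[of a 1 "1 - z2"] z ab
    by (simp add: algebra_simps)
  have "0 \<le> (1 - a) * (1 - b)" using ab by simp
  then have q: "a^2 + b^2 \<le> 1 + (a + b - 1)^2" by (simp add: power2_eq_square algebra_simps)
  show ?thesis
  proof (cases "1 \<le> a + b")
    case True
    then have "(a + b - 1)^2 \<le> (2 - z1 - z2)^2" using s by (intro power_mono) auto
    then show ?thesis using q c by linarith
  next
    case False
    have "a^2 \<le> a" "b^2 \<le> b"
      using ab mult_left_mono[of a 1 a] mult_left_mono[of b 1 b] by (auto simp: power2_eq_square)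
    then show ?thesis using False c zero_le_power2[of "2 - z1 - z2"] by linarith
  qed
qed

text \<open>
  In the application \<open>(z1, z2)\<close> and \<open>(a, b)\<close> are, up to signs, the coordinates of two vectors with
  respect to a pair with largest cross product. In units of that cross product, and again up to
  signs, \<open>a\<close> and \<open>b\<close> are the cross products of the second vector with the pair, and
  \<open>z1 * b - z2 * a\<close> is its cross product with the first vector.
\<close>

lemma third_vector_bound:
  fixes a b z1 z2 :: real
  assumes z: "0 \<le> z1" "z1 \<le> 1" "0 \<le> z2" "z2 \<le> 1" "1 < z1 + z2"
    and ab: "\<bar>a\<bar> \<le> 1" "\<bar>b\<bar> \<le> 1" "\<bar>z1 * b - z2 * a\<bar> \<le> 1"
  shows "a^2 + b^2 + (z1 * b - z2 * a)^2 \<le> 2 + (2 - z1 - z2)^2"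
proof -
  have same: "a^2 + b^2 + (z1 * b - z2 * a)^2 \<le> 2 + (2 - z1 - z2)^2"
    if "0 \<le> a" "a \<le> 1" "0 \<le> b" "b \<le> 1" for a b
  proof (cases "0 \<le> z1 * b - z2 * a")
    case True
    then show ?thesis using third_vector_bound_same_signs z that by blast
  next
    case False
    then have "b^2 + a^2 + (z2 * a - z1 * b)^2 \<le> 2 + (2 - z2 - z1)^2"
      using z that by (intro third_vector_bound_same_signs) auto
    then show ?thesis using power2_commute[of "z1 * b" "z2 * a"] by (simp add: algebra_simps)
  qed
  have opp: "a^2 + b^2 + (z1 * b + z2 * a)^2 \<le> 2 + (2 - z1 - z2)^2"
    if "0 \<le> a" "a \<le> 1" "0 \<le> b" "b \<le> 1" "z1 * b + z2 * a \<le> 1" for a b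
    using third_vector_bound_opposite_signs z that by blast
  consider "0 \<le> a" "0 \<le> b" | "a \<le> 0" "b \<le> 0" | "0 \<le> a" "b \<le> 0" | "a \<le> 0" "0 \<le> b" by linarith
  then show ?thesis
  proof cases
    case 1
    then show ?thesis using same[of a b] ab by simp
  next
    case 2
    have "(z1 * - b - z2 * - a)^2 = (z1 * b - z2 * a)^2"
      by (simp add: power2_eq_square algebra_simps)
    then show ?thesis using same[of "-a" "-b"] ab 2 by simp
  next
    case 3
    have "(z1 * - b + z2 * a)^2 = (z1 * b - z2 * a)^2"
      by (simp add: power2_eq_square algebra_simps)
    then show ?thesis using opp[of a "-b"] ab 3 by simp
  next
    case 4
    have "(z1 * b + z2 * - a)^2 = (z1 * b - z2 * a)^2"
      by (simp add: power2_eq_square algebra_simps)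
    then show ?thesis using opp[of "-a" b] ab 4 by simp
  qed
qed

section \<open>Areas of intersections of strips\<close>

definition cross2 :: "real ^ 2 \<Rightarrow> real ^ 2 \<Rightarrow> real" where
  "cross2 x y = x $ 1 * y $ 2 - x $ 2 * y $ 1"

text \<open>
  In the coordinates \<open>(x \<bullet> u, x \<bullet> w)\<close> the common part of the strips of \<open>u\<close> and \<open>w\<close> is mapped into the square \<open>[-1, 1]\<^sup>2\<close>, so all area
  estimates reduce to that square.
\<close>

lemma measure_image_inner_pair:
  fixes u w :: "real ^ 2"
  assumes "P \<in> lmeasurable"
  shows "(\<lambda>x. vector [x \<bullet> u, x \<bullet> w] :: real ^ 2) ` P \<in> lmeasurable"
    and "measure lebesgue ((\<lambda>x. vector [x \<bullet> u, x \<bullet> w] :: real ^ 2) ` P)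
      = \<bar>cross2 u w\<bar> * measure lebesgue P"
proof -
  let ?T = "\<lambda>x. vector [x \<bullet> u, x \<bullet> w] :: real ^ 2"
  have lin: "linear ?T"
    by (intro linearI) (simp_all add: vec_eq_iff forall_2 inner_add_left)
  then show "?T ` P \<in> lmeasurable"
    using assms by (rule measurable_linear_image)
  have "det (matrix ?T) = cross2 u w"
    by (simp add: det_2 matrix_def cross2_def inner_axis inner_axis' mult.commute)
  then show "measure lebesgue (?T ` P) = \<bar>cross2 u w\<bar> * measure lebesgue P"
    using measure_linear_image[OF lin assms] by simp
qed

lemma area_square:
  "measure lebesgue (cbox (vector [-1, -1]) (vector [1, 1] :: real ^ 2)) = 4"
proof -
  have "vector [1, 1] \<in> cbox (vector [-1, -1]) (vector [1, 1] :: real ^ 2)"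
    by (simp add: mem_box_cart forall_2)
  then have "cbox (vector [-1, -1]) (vector [1, 1] :: real ^ 2) \<noteq> {}" by blast
  then show ?thesis by (simp add: content_cbox_cart UNIV_2)
qed

lemma area_two_strips_le:
  fixes u w :: "real ^ 2"
  assumes P: "P \<in> lmeasurable" and u: "\<And>x. x \<in> P \<Longrightarrow> \<bar>x \<bullet> u\<bar> \<le> 1"
    and w: "\<And>x. x \<in> P \<Longrightarrow> \<bar>x \<bullet> w\<bar> \<le> 1"
  shows "\<bar>cross2 u w\<bar> * measure lebesgue P \<le> 4"
proof -
  have "(\<lambda>x. vector [x \<bullet> u, x \<bullet> w] :: real ^ 2) ` P \<subseteq> cbox (vector [-1, -1]) (vector [1, 1])"
    using u w by (force simp: mem_box_cart forall_2 abs_le_iff)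
  then have "measure lebesgue ((\<lambda>x. vector [x \<bullet> u, x \<bullet> w] :: real ^ 2) ` P) \<le> 4"
    unfolding area_square[symmetric]
    by (intro measure_mono_fmeasurable fmeasurableD measure_image_inner_pair P) auto
  then show ?thesis by (simp add: measure_image_inner_pair P)
qed

text \<open>
  The strip of \<open>(z1, z2)\<close> cuts off two opposite corners of the square: right triangles with legs
  \<open>d / z1\<close> and \<open>d / z2\<close> for \<open>d = z1 + z2 - 1\<close>. As \<open>z1, z2 \<le> 1\<close>, the legs have length at most \<open>1\<close>, so
  the triangles lie in the square.
\<close>

lemma area_truncated_square_le:
  fixes Q :: "(real ^ 2) set"
  assumes Q: "Q \<in> lmeasurable" and sq: "\<And>q i. q \<in> Q \<Longrightarrow> \<bar>q $ i\<bar> \<le> 1"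
    and strip: "\<And>q. q \<in> Q \<Longrightarrow> \<bar>z1 * q $ 1 + z2 * q $ 2\<bar> \<le> 1"
    and z: "0 < z1" "z1 \<le> 1" "0 < z2" "z2 \<le> 1" "1 \<le> z1 + z2"
  shows "measure lebesgue Q \<le> 4 - (z1 + z2 - 1)^2 / (z1 * z2)"
proof -
  define d where "d = z1 + z2 - 1"
  define z :: "real ^ 2" where "z = vector [z1, z2]"
  define \<Delta> :: "(real ^ 2) set"
    where "\<Delta> = convex hull {vector [1, 1], vector [1 - d/z1, 1], vector [1, 1 - d/z2]}"
  have d0: "0 \<le> d" "d \<le> z1" "d \<le> z2" using z by (auto simp: d_def)
  have dz: "d / z1 \<le> 2" "d / z2 \<le> 2" using z d0 by (simp_all add: divide_le_eq)
  have z0: "z \<noteq> 0" using z by (auto simp: z_def vec_eq_iff forall_2)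
  have \<Delta>m: "\<Delta> \<in> lmeasurable" "uminus ` \<Delta> \<in> lmeasurable"
    unfolding \<Delta>_def by (intro lmeasurable_compact compact_negations finite_imp_compact_convex_hull; simp)+
  have \<Delta>area: "measure lebesgue \<Delta> = d^2 / (2 * z1 * z2)"
  proof -
    have "compact \<Delta>"
      unfolding \<Delta>_def by (intro finite_imp_compact_convex_hull) simp
    then have "measure lebesgue \<Delta> = measure lborel \<Delta>"
      by (intro measure_completion) (simp add: borel_compact)
    then show ?thesis
      unfolding \<Delta>_def using z d0 by (simp add: content_triangle power2_eq_square)
  qed
  have \<Delta>'area: "measure lebesgue (uminus ` \<Delta>) = d^2 / (2 * z1 * z2)"
    using measure_lebesgue_affine[of "-1" 0 \<Delta>] \<Delta>area by simp
  have \<Delta>sq: "\<Delta> \<subseteq> cbox (vector [-1, -1]) (vector [1, 1])"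
    unfolding \<Delta>_def using z d0 dz
    by (intro hull_minimal convex_box) (auto simp: mem_box_cart forall_2)
  have \<Delta>z: "\<Delta> \<subseteq> {q. z \<bullet> q \<ge> 1}"
    unfolding \<Delta>_def using z
    by (intro hull_minimal convex_halfspace_ge)
      (auto simp: z_def inner_vec_def sum_2 d_def field_simps)
  have \<Delta>'z: "uminus ` \<Delta> \<subseteq> {q. z \<bullet> q \<le> -1}" using \<Delta>z by auto
  have Qz: "Q \<subseteq> {q. z \<bullet> q \<le> 1}" "Q \<subseteq> {q. z \<bullet> q \<ge> -1}"
    using strip by (auto simp: z_def inner_vec_def sum_2 abs_le_iff) (smt (verit))+
  have H: "negligible {q. z \<bullet> q = c}" for c using z0 by (simp add: negligible_hyperplane)
  have "measure lebesgue (Q \<union> \<Delta> \<union> uminus ` \<Delta>)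
      = measure lebesgue Q + measure lebesgue \<Delta> + measure lebesgue (uminus ` \<Delta>)"
  proof (rule measure_Un3_negligible)
    show "negligible (Q \<inter> \<Delta>)"
      using Qz(1) \<Delta>z by (intro negligible_subset[OF H[of 1]]) force
    show "negligible (Q \<inter> uminus ` \<Delta>)"
      using Qz(2) \<Delta>'z by (intro negligible_subset[OF H[of "-1"]]) force
    show "negligible (\<Delta> \<inter> uminus ` \<Delta>)"
      using \<Delta>z \<Delta>'z by (intro negligible_subset[OF H[of 1]]) force
  qed (use Q \<Delta>m in auto)
  moreover have "measure lebesgue (Q \<union> \<Delta> \<union> uminus ` \<Delta>) \<le> 4"
    unfolding area_square[symmetric]
  proof (rule measure_mono_fmeasurable)
    have "Q \<subseteq> cbox (vector [-1, -1]) (vector [1, 1])"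
      using sq by (force simp: mem_box_cart forall_2 abs_le_iff)
    moreover have "uminus ` \<Delta> \<subseteq> cbox (vector [-1, -1]) (vector [1, 1])"
      using \<Delta>sq by (force simp: mem_box_cart forall_2)
    ultimately show "Q \<union> \<Delta> \<union> uminus ` \<Delta> \<subseteq> cbox (vector [-1, -1]) (vector [1, 1])"
      using \<Delta>sq by auto
    show "Q \<union> \<Delta> \<union> uminus ` \<Delta> \<in> sets lebesgue"
      using Q \<Delta>m by (auto intro: fmeasurableD)
  qed auto
  ultimately have "measure lebesgue Q \<le> 4 - 2 * (d^2 / (2 * z1 * z2))"
    using \<Delta>area \<Delta>'area by linarith
  then show ?thesis by (simp add: d_def)
qed

text \<open>
  Changing the signs of \<open>u\<close> and \<open>w\<close> does not change their strips, which reduces to positive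
  coefficients.
\<close>

lemma area_three_strips_le:
  fixes u w :: "real ^ 2"
  assumes P: "P \<in> lmeasurable" and u: "\<And>x. x \<in> P \<Longrightarrow> \<bar>x \<bullet> u\<bar> \<le> 1"
    and w: "\<And>x. x \<in> P \<Longrightarrow> \<bar>x \<bullet> w\<bar> \<le> 1"
    and z: "\<And>x. x \<in> P \<Longrightarrow> \<bar>x \<bullet> (c1 *\<^sub>R u + c2 *\<^sub>R w)\<bar> \<le> 1"
    and c: "\<bar>c1\<bar> \<le> 1" "\<bar>c2\<bar> \<le> 1" "1 < \<bar>c1\<bar> + \<bar>c2\<bar>"
  shows "\<bar>cross2 u w\<bar> * measure lebesgue P \<le> 4 - (\<bar>c1\<bar> + \<bar>c2\<bar> - 1)^2 / (\<bar>c1\<bar> * \<bar>c2\<bar>)"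
proof -
  have c0: "c1 \<noteq> 0" "c2 \<noteq> 0" using c by auto
  define u' where "u' = sgn c1 *\<^sub>R u"
  define w' where "w' = sgn c2 *\<^sub>R w"
  let ?Q = "(\<lambda>x. vector [x \<bullet> u', x \<bullet> w'] :: real ^ 2) ` P"
  have "measure lebesgue ?Q \<le> 4 - (\<bar>c1\<bar> + \<bar>c2\<bar> - 1)^2 / (\<bar>c1\<bar> * \<bar>c2\<bar>)"
  proof (rule area_truncated_square_le)
    show "?Q \<in> lmeasurable" using P by (rule measure_image_inner_pair)
    have "\<forall>i. \<bar>q $ i\<bar> \<le> 1" if "q \<in> ?Q" for q
      using that u w c0 by (auto simp: forall_2 u'_def w'_def abs_mult abs_sgn_eq)
    then show "\<bar>q $ i\<bar> \<le> 1" if "q \<in> ?Q" for q i using that by blast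
    show "\<bar>\<bar>c1\<bar> * q $ 1 + \<bar>c2\<bar> * q $ 2\<bar> \<le> 1" if q: "q \<in> ?Q" for q
    proof -
      obtain x where x: "x \<in> P" "q = vector [x \<bullet> u', x \<bullet> w']" using q by auto
      have "\<bar>c1\<bar> * (x \<bullet> u') + \<bar>c2\<bar> * (x \<bullet> w') = x \<bullet> (c1 *\<^sub>R u + c2 *\<^sub>R w)"
        by (simp add: u'_def w'_def inner_add_right mult.assoc[symmetric] abs_mult_sgn)
      then show ?thesis using z[OF x(1)] x(2) by simp
    qed
  qed (use c c0 in auto)
  moreover have "\<bar>cross2 u' w'\<bar> = \<bar>cross2 u w\<bar>"
  proof -
    have "cross2 u' w' = (sgn c1 * sgn c2) * cross2 u w"
      by (simp add: cross2_def u'_def w'_def algebra_simps)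
    then show ?thesis using c0 by (simp add: abs_mult abs_sgn_eq)
  qed
  ultimately show ?thesis by (simp add: measure_image_inner_pair P)
qed

section \<open>Strips around a common set satisfy the removal condition\<close>

lemma cross2_expand:
  assumes "cross2 u w \<noteq> 0"
  shows "z = (cross2 z w / cross2 u w) *\<^sub>R u + (cross2 u z / cross2 u w) *\<^sub>R w"
  using assms by (simp add: vec_eq_iff forall_2 field_simps) (simp add: cross2_def algebra_simps)

lemma cross2_Pluecker:
  "cross2 a b * cross2 k l = cross2 k b * cross2 a l - cross2 a k * cross2 l b"
  by (simp add: cross2_def algebra_simps)

text \<open>
  The pair \<open>i, j\<close> with the largest cross product serves as a basis. By maximality all coordinates
  \<open>c1, c2\<close> with respect to it lie in \<open>[-1, 1]\<close>, and the weights are \<open>x\<^sup>2\<close> times squares of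
  coordinates or of \<open>2 \<times> 2\<close> minors of coordinates. Either this pair can be removed, or a vector \<open>k\<close>
  that violates the condition completes it to a removable triple.
\<close>

lemma strips_removable:
  fixes u :: "'i \<Rightarrow> real ^ 2"
  defines "y \<equiv> \<lambda>P i j. (measure lebesgue P / 4 * cross2 (u i) (u j))^2"
  assumes P: "P \<in> lmeasurable" and strip: "\<And>x i. x \<in> P \<Longrightarrow> i \<in> T \<Longrightarrow> \<bar>x \<bullet> u i\<bar> \<le> 1"
    and T: "2 \<le> card T"
  shows "removable_pair (y P) T \<or> removable_triple (y P) T"
proof -
  define A where "A = measure lebesgue P"
  have fin: "finite T" using T by (metis card.infinite not_numeral_le_zero)
  have "T \<noteq> {}" using T by auto
  obtain i j where ij: "i \<in> T" "j \<in> T"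
    and max: "\<And>k l. k \<in> T \<Longrightarrow> l \<in> T \<Longrightarrow> \<bar>cross2 (u k) (u l)\<bar> \<le> \<bar>cross2 (u i) (u j)\<bar>"
  proof -
    define F where "F = (\<lambda>(k, l). \<bar>cross2 (u k) (u l)\<bar>)"
    have F: "finite (F ` (T \<times> T))" "F ` (T \<times> T) \<noteq> {}" using fin \<open>T \<noteq> {}\<close> by auto
    obtain p where p: "p \<in> T \<times> T" "F p = Max (F ` (T \<times> T))"
      using Max_in[OF F] by (metis imageE)
    obtain i j where "p = (i, j)" by (cases p)
    then have "i \<in> T" "j \<in> T" using p by auto
    moreover have "\<bar>cross2 (u k) (u l)\<bar> \<le> \<bar>cross2 (u i) (u j)\<bar>" if "k \<in> T" "l \<in> T" for k l
    proof -
      have "F (k, l) \<le> F (i, j)"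
        unfolding p(2)[unfolded \<open>p = (i, j)\<close>] using that by (intro Max_ge F imageI) simp
      then show ?thesis by (simp add: F_def)
    qed
    ultimately show ?thesis using that by blast
  qed
  define D where "D = cross2 (u i) (u j)"
  show ?thesis
  proof (cases "D = 0")
    case True
    then have "y P k l = 0" if "k \<in> T" "l \<in> T" for k l
      using max[OF that] by (simp add: y_def D_def)
    moreover obtain k l where "k \<in> T" "l \<in> T" "k \<noteq> l"
      using T card_le_Suc0_iff_eq[OF fin] by fastforce
    ultimately have "removable_pair (y P) T" unfolding removable_pair_def by force
    then show ?thesis ..
  next
    case False
    define x where "x = A / 4 * \<bar>D\<bar>"
    define c1 where "c1 k = cross2 (u k) (u j) / D" for k
    define c2 where "c2 k = cross2 (u i) (u k) / D" for k
    have i_j: "i \<noteq> j" using False by (auto simp: D_def cross2_def)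
    have x: "0 \<le> x" "x \<le> 1"
      using area_two_strips_le[of P "u i" "u j"] P strip ij
      by (auto simp: x_def A_def D_def mult.commute)
    have c: "\<bar>c1 k\<bar> \<le> 1" "\<bar>c2 k\<bar> \<le> 1" if "k \<in> T" for k
      using max[of k j] max[of i k] ij that False by (auto simp: c1_def c2_def D_def)
    have yij: "y P i j = x^2" by (simp add: y_def x_def A_def D_def power_mult_distrib power_divide)
    have yi: "y P i k = x^2 * (c2 k)^2" for k
      using False by (simp add: y_def x_def A_def c2_def power_mult_distrib power_divide)
    have yj: "y P j k = x^2 * (c1 k)^2" for k
    proof -
      have "(cross2 (u k) (u j))^2 = (cross2 (u j) (u k))^2"
        by (simp add: cross2_def power2_eq_square algebra_simps)
      then show ?thesis
        using False by (simp add: y_def x_def A_def c1_def power_mult_distrib power_divide)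
    qed
    have C: "cross2 (u k) (u l) = D * (c1 k * c2 l - c2 k * c1 l)" for k l
    proof -
      have "D * cross2 (u k) (u l)
          = cross2 (u k) (u j) * cross2 (u i) (u l) - cross2 (u i) (u k) * cross2 (u l) (u j)"
        unfolding D_def by (rule cross2_Pluecker)
      also have "\<dots> = (D * c1 k) * (D * c2 l) - (D * c2 k) * (D * c1 l)"
        using False by (simp add: c1_def c2_def)
      also have "\<dots> = D * (D * (c1 k * c2 l - c2 k * c1 l))" by (simp add: algebra_simps)
      finally show ?thesis using False by simp
    qed
    have ykl: "y P k l = x^2 * (c1 k * c2 l - c2 k * c1 l)^2" for k l
      by (simp add: y_def C x_def A_def power_mult_distrib power_divide)
    show ?thesis
    proof (cases "\<forall>k\<in>T - {i, j}. y P i k + y P j k \<le> 1")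
      case True
      moreover have "y P i j \<le> 1" unfolding yij using x by (intro power_le_one)
      ultimately have "removable_pair (y P) T"
        unfolding removable_pair_def using ij i_j by blast
      then show ?thesis ..
    next
      case not_pair: False
      then obtain k where k: "k \<in> T" "k \<noteq> i" "k \<noteq> j" and fail: "1 < y P i k + y P j k" by force
      define z1 where "z1 = \<bar>c1 k\<bar>"
      define z2 where "z2 = \<bar>c2 k\<bar>"
      have z: "0 \<le> z1" "z1 \<le> 1" "0 \<le> z2" "z2 \<le> 1"
        using c[OF k(1)] by (auto simp: z1_def z2_def)
      have cut: "x \<le> 1 - (z1 + z2 - 1)^2 / (4 * z1 * z2)" if "1 < z1 + z2"
      proof -
        have uk: "u k = c1 k *\<^sub>R u i + c2 k *\<^sub>R u j"
          unfolding c1_def c2_def D_def using False by (intro cross2_expand) (simp add: D_def)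
        have "\<bar>cross2 (u i) (u j)\<bar> * measure lebesgue P \<le> 4 - (z1 + z2 - 1)^2 / (z1 * z2)"
          unfolding z1_def z2_def
        proof (rule area_three_strips_le[OF P])
          show "\<bar>p \<bullet> (c1 k *\<^sub>R u i + c2 k *\<^sub>R u j)\<bar> \<le> 1" if "p \<in> P" for p
            using strip[OF that k(1)] uk by simp
        qed (use strip ij c[OF k(1)] that in \<open>auto simp: z1_def z2_def\<close>)
        then show ?thesis by (simp add: x_def A_def D_def mult.commute)
      qed
      have "1 < x^2 * (z1^2 + z2^2)"
        using fail by (simp add: yi yj z1_def z2_def algebra_simps)
      note bounds = failing_pair_bounds[OF z x cut this]
      have "y P i j + y P i k + y P j k < 2"
        using bounds(3) by (simp add: yij yi[of k] yj[of k] z1_def z2_def algebra_simps)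
      moreover have "y P i l + y P j l + y P k l \<le> 3/2" if "l \<in> T - {i, j, k}" for l
      proof -
        \<comment> \<open>reversing basis vectors makes the coordinates of \<open>k\<close> positive, namely \<open>z1\<close> and \<open>z2\<close>\<close>
        define a where "a = sgn (c1 k) * c1 l"
        define b where "b = sgn (c2 k) * c2 l"
        have nz: "c1 k \<noteq> 0" "c2 k \<noteq> 0"
          using bounds(1) z by (auto simp: z1_def z2_def)
        have e: "c1 k * c2 l - c2 k * c1 l = sgn (c1 k) * sgn (c2 k) * (z1 * b - z2 * a)"
          using nz by (simp add: a_def b_def z1_def z2_def sgn_if)
        have q: "(c1 k * c2 l - c2 k * c1 l)^2 = (z1 * b - z2 * a)^2"
          unfolding e using nz by (simp add: power_mult_distrib sgn_if)
        have "\<bar>z1 * b - z2 * a\<bar> \<le> 1"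
        proof -
          have "\<bar>cross2 (u k) (u l)\<bar> \<le> \<bar>D\<bar>" using max k that by (auto simp: D_def)
          then have "\<bar>c1 k * c2 l - c2 k * c1 l\<bar> \<le> 1"
            using False by (simp add: C abs_mult)
          then show ?thesis using e nz by (simp add: abs_mult abs_sgn_eq)
        qed
        then have "a^2 + b^2 + (z1 * b - z2 * a)^2 \<le> 2 + (2 - z1 - z2)^2"
          using c[of l] that z bounds(1) nz
          by (intro third_vector_bound) (auto simp: a_def b_def abs_mult abs_sgn_eq)
        then have "x^2 * (a^2 + b^2 + (z1 * b - z2 * a)^2) \<le> x^2 * (2 + (2 - z1 - z2)^2)"
          by (intro mult_left_mono) auto
        moreover have "a^2 = (c1 l)^2" "b^2 = (c2 l)^2"
          using nz by (auto simp: a_def b_def power_mult_distrib sgn_if)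
        moreover have "y P i l + y P j l + y P k l = x^2 * (c2 l)^2 + x^2 * (c1 l)^2
            + x^2 * (z1 * b - z2 * a)^2"
          using yi[of l] yj[of l] ykl[of k l] q by simp
        ultimately show ?thesis using bounds(2) by (simp add: distrib_left)
      qed
      ultimately have "\<exists>k\<in>T. i \<noteq> j \<and> i \<noteq> k \<and> j \<noteq> k \<and> y P i j + y P i k + y P j k < 2 \<and>
          (\<forall>l\<in>T - {i, j, k}. y P i l + y P j l + y P k l \<le> 3/2)"
        using k i_j by (intro bexI[of _ k]) auto
      then have "removable_triple (y P) T"
        unfolding removable_triple_def using ij by blast
      then show ?thesis ..
    qed
  qed
qed

section \<open>Parallelograms and rectangles\<close>

text \<open>
  The set on the right is better suited to coordinates than the convex hull in \<open>is_rectangle\<close>.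
\<close>

lemma convex_hull_parallelogram:
  fixes p v w :: "'a::real_vector"
  shows "convex hull {p, p + v, p + v + w, p + w}
    = {p + s *\<^sub>R v + t *\<^sub>R w | s t. 0 \<le> s \<and> s \<le> 1 \<and> 0 \<le> t \<and> t \<le> 1}" (is "?C = ?R")
proof
  show "?C \<subseteq> ?R"
  proof (rule hull_minimal)
    have "p = p + 0 *\<^sub>R v + 0 *\<^sub>R w" "p + v = p + 1 *\<^sub>R v + 0 *\<^sub>R w"
      "p + v + w = p + 1 *\<^sub>R v + 1 *\<^sub>R w" "p + w = p + 0 *\<^sub>R v + 1 *\<^sub>R w"
      by simp_all
    then show "{p, p + v, p + v + w, p + w} \<subseteq> ?R"
      by (smt (verit, best) insert_iff mem_Collect_eq singleton_iff subsetI)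
    show "convex ?R"
    proof (rule convexI)
      fix x y :: 'a and a b :: real
      assume xy: "x \<in> ?R" "y \<in> ?R" and ab: "0 \<le> a" "0 \<le> b" "a + b = 1"
      then obtain s t s' t' where x: "x = p + s *\<^sub>R v + t *\<^sub>R w" "0 \<le> s" "s \<le> 1" "0 \<le> t" "t \<le> 1"
        and y: "y = p + s' *\<^sub>R v + t' *\<^sub>R w" "0 \<le> s'" "s' \<le> 1" "0 \<le> t'" "t' \<le> 1" by blast
      have "a *\<^sub>R p + b *\<^sub>R p = p" using ab(3) by (metis scaleR_add_left scaleR_one)
      then have "a *\<^sub>R x + b *\<^sub>R y = p + (a * s + b * s') *\<^sub>R v + (a * t + b * t') *\<^sub>R w"
        unfolding x y by (simp add: algebra_simps)
      moreover have "a * s + b * s' \<le> 1" "a * t + b * t' \<le> 1"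
        using x y ab by (auto intro!: convex_bound_le)
      moreover have "0 \<le> a * s + b * s'" "0 \<le> a * t + b * t'" using x y ab by auto
      ultimately show "a *\<^sub>R x + b *\<^sub>R y \<in> ?R" by blast
    qed
  qed
  show "?R \<subseteq> ?C"
  proof
    fix x assume "x \<in> ?R"
    then obtain s t where x: "x = p + s *\<^sub>R v + t *\<^sub>R w" and st: "0 \<le> s" "s \<le> 1" "0 \<le> t" "t \<le> 1"
      by blast
    have "(1 - t) *\<^sub>R p + t *\<^sub>R (p + w) \<in> ?C" "(1 - t) *\<^sub>R (p + v) + t *\<^sub>R (p + v + w) \<in> ?C"
      by (intro convexD_alt hull_inc; use st in simp)+
    then have "(1 - s) *\<^sub>R ((1 - t) *\<^sub>R p + t *\<^sub>R (p + w))
        + s *\<^sub>R ((1 - t) *\<^sub>R (p + v) + t *\<^sub>R (p + v + w)) \<in> ?C"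
      using convexD_alt[OF convex_convex_hull _ _ st(1,2)] by blast
    then show "x \<in> ?C" unfolding x by (simp add: algebra_simps)
  qed
qed

lemma cross2_square: "(cross2 v w)^2 = (v \<bullet> v) * (w \<bullet> w) - (v \<bullet> w)^2"
  by (simp add: cross2_def inner_vec_def sum_2 power2_eq_square algebra_simps)

lemma measure_parallelogram:
  fixes p v w :: "real ^ 2"
  shows "measure lebesgue {p + s *\<^sub>R v + t *\<^sub>R w | s t. 0 \<le> s \<and> s \<le> 1 \<and> 0 \<le> t \<and> t \<le> 1}
    = \<bar>cross2 v w\<bar>"
proof -
  define L where "L x = (x $ 1) *\<^sub>R v + (x $ 2) *\<^sub>R w" for x :: "real ^ 2"
  let ?U = "cbox (vector [0, 0]) (vector [1, 1]) :: (real ^ 2) set"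
  have lin: "linear L" by (intro linearI) (simp_all add: L_def algebra_simps)
  have "vector [1, 1] \<in> ?U" by (simp add: mem_box_cart forall_2)
  then have "?U \<noteq> {}" by blast
  then have U: "measure lebesgue ?U = 1" by (simp add: content_cbox_cart UNIV_2)
  have "{p + s *\<^sub>R v + t *\<^sub>R w | s t. 0 \<le> s \<and> s \<le> 1 \<and> 0 \<le> t \<and> t \<le> 1} = (+) p ` L ` ?U" (is "?R = _")
  proof
    show "?R \<subseteq> (+) p ` L ` ?U"
    proof
      fix x assume "x \<in> ?R"
      then obtain s t where x: "x = p + s *\<^sub>R v + t *\<^sub>R w" and st: "0 \<le> s" "s \<le> 1" "0 \<le> t" "t \<le> 1"
        by blast
      have "x = p + L (vector [s, t])" by (simp add: x L_def)
      moreover have "vector [s, t] \<in> ?U" using st by (simp add: mem_box_cart forall_2)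
      ultimately show "x \<in> (+) p ` L ` ?U" by blast
    qed
    show "(+) p ` L ` ?U \<subseteq> ?R"
      by (force simp: mem_box_cart forall_2 L_def)
  qed
  then have "measure lebesgue ?R = measure lebesgue (L ` ?U)" by (simp add: measure_translation)
  also have "\<dots> = \<bar>det (matrix L)\<bar> * measure lebesgue ?U"
    by (rule measure_linear_image[OF lin]) simp
  also have "det (matrix L) = cross2 v w"
    by (simp add: det_2 matrix_def L_def cross2_def axis_def algebra_simps)
  finally show ?thesis by (simp add: U)
qed

lemma is_rectangle_commute: "is_rectangle S a b \<Longrightarrow> is_rectangle S b a"
proof -
  assume "is_rectangle S a b"
  then obtain p v w where pvw: "orthogonal v w" "norm v = a" "norm w = b"
    "S = convex hull {p, p + v, p + v + w, p + w}" unfolding is_rectangle_def by blast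
  have "{p, p + v, p + v + w, p + w} = {p, p + w, p + w + v, p + v}" by (auto simp: algebra_simps)
  then show ?thesis
    unfolding is_rectangle_def using pvw
    by - (rule exI[of _ p], rule exI[of _ w], rule exI[of _ v], simp add: orthogonal_commute)
qed

lemma plane_chart_inner:
  assumes "plane_chart H f"
  shows "f x \<bullet> f y = x \<bullet> y"
  using assms by (simp add: plane_chart_def dot_norm linear_add[symmetric])

lemma plane_chart_linear: "plane_chart H f \<Longrightarrow> linear f"
  by (simp add: plane_chart_def)

lemma area_rectangle:
  fixes H :: "(real ^ 'n) set"
  assumes H: "is_plane H" and S: "S \<subseteq> H" and rect: "is_rectangle S a b"
  shows "area H S = a * b"
proof -
  obtain f where f: "plane_chart H f" using plane_chart_exists[OF H] by blast
  have H': "subspace H" using H by (simp add: is_plane_def)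
  have lin: "linear f" and rng: "range f = H" using f by (auto simp: plane_chart_def)
  obtain p v w where pvw: "orthogonal v w" "norm v = a" "norm w = b"
    and hull: "S = convex hull {p, p + v, p + v + w, p + w}"
    using rect unfolding is_rectangle_def by blast
  have "p \<in> H" "p + v \<in> H" "p + w \<in> H"
    using S unfolding hull by (auto intro!: subsetD[OF S[unfolded hull]] hull_inc)
  then have "v \<in> H" "w \<in> H"
    using subspace_diff[OF H', of "p + v" p] subspace_diff[OF H', of "p + w" p] by auto
  then obtain p' v' w' where fs: "f p' = p" "f v' = v" "f w' = w"
    using \<open>p \<in> H\<close> rng by (metis imageE)
  have img: "f (p' + s *\<^sub>R v' + t *\<^sub>R w') = p + s *\<^sub>R v + t *\<^sub>R w" for s t
    by (simp add: linear_add[OF lin] linear_scale[OF lin] fs)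
  have "f -` S = {p' + s *\<^sub>R v' + t *\<^sub>R w' | s t. 0 \<le> s \<and> s \<le> 1 \<and> 0 \<le> t \<and> t \<le> 1}"
    unfolding hull convex_hull_parallelogram
    using plane_chart_inj[OF f] by (force simp: img[symmetric] inj_eq)
  moreover have "compact S" unfolding hull by (intro finite_imp_compact_convex_hull) simp
  ultimately have "area H S = \<bar>cross2 v' w'\<bar>"
    using area_eq[OF f] by (simp add: measure_parallelogram)
  moreover have "\<bar>cross2 v' w'\<bar> = a * b"
  proof -
    have "v' \<bullet> v' = a^2" "w' \<bullet> w' = b^2" "v' \<bullet> w' = 0"
      using pvw fs plane_chart_inner[OF f]
      by (metis dot_square_norm, metis dot_square_norm, metis orthogonal_def)
    then have "(cross2 v' w')^2 = (a * b)^2"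
      by (simp add: cross2_square power_mult_distrib)
    moreover have "0 \<le> a * b" using pvw by auto
    ultimately show ?thesis by (metis abs_of_nonneg power2_eq_iff abs_minus_cancel)
  qed
  ultimately show ?thesis by simp
qed

section \<open>Tight frames in the plane\<close>

text \<open>
  The orthogonal projection of the \<open>i\<close>-th standard basis vector to the plane, read in the chart.
\<close>

definition section_normal :: "(real ^ 2 \<Rightarrow> real ^ 'n) \<Rightarrow> 'n \<Rightarrow> real ^ 2" where
  "section_normal f i = adjoint f (axis i 1)"

lemma inner_section_normal:
  assumes "linear f"
  shows "x \<bullet> section_normal f i = f x $ i"
  using adjoint_works[OF assms, of x "axis i 1"]
  by (simp add: section_normal_def inner_axis)

lemma tight_frame_section_normal:
  assumes f: "plane_chart H f"
  shows "(\<Sum>i\<in>UNIV. (x \<bullet> section_normal f i) * (y \<bullet> section_normal f i)) = x \<bullet> y"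
  using plane_chart_inner[OF f, of x y] inner_section_normal[OF plane_chart_linear[OF f]]
  by (simp add: inner_vec_def)

text \<open>
  Lagrange's identity: the two coordinate sequences of the frame are orthonormal.
\<close>

lemma sum_cross2_square:
  fixes u :: "'n::finite \<Rightarrow> real ^ 2"
  assumes frame: "\<And>x y. (\<Sum>i\<in>UNIV. (x \<bullet> u i) * (y \<bullet> u i)) = x \<bullet> y"
  shows "(\<Sum>i\<in>UNIV. \<Sum>j\<in>UNIV. (cross2 (u i) (u j))^2) = 2"
proof -
  have e: "axis k 1 \<bullet> u i = u i $ k" for k i by (simp add: inner_axis')
  have 1: "(\<Sum>i\<in>UNIV. u i $ 1 * u i $ 1) = 1" "(\<Sum>i\<in>UNIV. u i $ 2 * u i $ 2) = 1"
    "(\<Sum>i\<in>UNIV. u i $ 1 * u i $ 2) = 0"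
    using frame[of "axis 1 1" "axis 1 1"] frame[of "axis 2 1" "axis 2 1"] frame[of "axis 1 1" "axis 2 1"]
    by (simp_all add: e inner_axis_axis)
  have "(cross2 (u i) (u j))^2 = (u i $ 1 * u i $ 1) * (u j $ 2 * u j $ 2)
      + (u i $ 2 * u i $ 2) * (u j $ 1 * u j $ 1)
      - 2 * ((u i $ 1 * u i $ 2) * (u j $ 1 * u j $ 2))" for i j
    by (simp add: cross2_def power2_eq_square algebra_simps)
  then show ?thesis
    by (simp add: sum.distrib sum_subtractf sum_distrib_left[symmetric] sum_distrib_right[symmetric] 1)
qed

text \<open>
  The frame identity is evaluated at the vectors \<open>J v\<close> and \<open>J w\<close>, rotated by a right angle: each of
  them is orthogonal to one of the two directions.
\<close>

lemma tight_frame_two_directions: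
  fixes v w :: "real ^ 2" and k l :: real
  assumes frame: "\<And>x y. k * (x \<bullet> v) * (y \<bullet> v) + l * (x \<bullet> w) * (y \<bullet> w) = x \<bullet> y"
    and D: "cross2 v w \<noteq> 0"
  shows "v \<bullet> w = 0" "k * (v \<bullet> v) = 1" "l * (w \<bullet> w) = 1"
proof -
  define J :: "real ^ 2 \<Rightarrow> real ^ 2" where "J x = vector [- x $ 2, x $ 1]" for x
  have J: "J x \<bullet> y = cross2 x y" for x y
    by (simp add: J_def cross2_def inner_vec_def sum_2)
  have JJ: "J v \<bullet> J w = v \<bullet> w" "J v \<bullet> J v = v \<bullet> v" "J w \<bullet> J w = w \<bullet> w"
    by (simp_all add: J_def inner_vec_def sum_2)
  have c: "cross2 w v = - cross2 v w" "cross2 v v = 0" "cross2 w w = 0"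
    by (simp_all add: cross2_def)
  show vw: "v \<bullet> w = 0"
    using frame[of "J v" "J w"] unfolding JJ by (simp add: J c)
  have v: "v \<bullet> v = l * (cross2 v w)^2" and w: "w \<bullet> w = k * (cross2 v w)^2"
    using frame[of "J v" "J v"] frame[of "J w" "J w"] unfolding JJ
    by (simp_all add: J c power2_eq_square)
  have "(cross2 v w)^2 = (v \<bullet> v) * (w \<bullet> w)" using vw by (simp add: cross2_square)
  moreover have "k * (v \<bullet> v) * (cross2 v w)^2 = (v \<bullet> v) * (w \<bullet> w)"
    unfolding w by (simp only: mult_ac)
  moreover have "l * (w \<bullet> w) * (cross2 v w)^2 = (v \<bullet> v) * (w \<bullet> w)"
    unfolding v by (simp only: mult_ac)
  ultimately have "k * (v \<bullet> v) * (cross2 v w)^2 = 1 * (cross2 v w)^2"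
    "l * (w \<bullet> w) * (cross2 v w)^2 = 1 * (cross2 v w)^2" by simp_all
  then show "k * (v \<bullet> v) = 1" "l * (w \<bullet> w) = 1" using D mult_right_cancel[of "(cross2 v w)^2"] by auto
qed

text \<open>
  \<open>v\<close> and \<open>w\<close> are orthogonal of lengths \<open>1 / sqrt k\<close> and \<open>1 / sqrt l\<close>, so the strips have widths
  \<open>2 * sqrt k\<close> and \<open>2 * sqrt l\<close>.
\<close>

lemma two_strips_rectangle:
  fixes v w :: "real ^ 2" and k l :: real
  assumes frame: "\<And>x y. k * (x \<bullet> v) * (y \<bullet> v) + l * (x \<bullet> w) * (y \<bullet> w) = x \<bullet> y"
    and D: "cross2 v w \<noteq> 0" and kl: "0 < k" "0 < l"
  shows "is_rectangle {x. \<bar>x \<bullet> v\<bar> \<le> 1 \<and> \<bar>x \<bullet> w\<bar> \<le> 1} (2 * sqrt k) (2 * sqrt l)"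
    and "(cross2 v w)^2 * (k * l) = 1"
proof -
  note o = tight_frame_two_directions[OF frame D]
  have wv: "w \<bullet> v = 0" using o(1) by (simp add: inner_commute)
  have x: "x = (k * (x \<bullet> v)) *\<^sub>R v + (l * (x \<bullet> w)) *\<^sub>R w" for x
  proof -
    have "x \<bullet> z = ((k * (x \<bullet> v)) *\<^sub>R v + (l * (x \<bullet> w)) *\<^sub>R w) \<bullet> z" for z
      using frame[of x z] by (simp add: inner_add_left inner_commute[of v z] inner_commute[of w z])
    then show ?thesis by (metis vector_eq_rdot)
  qed
  let ?p = "(- k) *\<^sub>R v + (- l) *\<^sub>R w"
  have "{x. \<bar>x \<bullet> v\<bar> \<le> 1 \<and> \<bar>x \<bullet> w\<bar> \<le> 1}
      = {?p + s *\<^sub>R ((2 * k) *\<^sub>R v) + t *\<^sub>R ((2 * l) *\<^sub>R w) | s t. 0 \<le> s \<and> s \<le> 1 \<and> 0 \<le> t \<and> t \<le> 1}"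
    (is "?P = ?R")
  proof
    show "?P \<subseteq> ?R"
    proof
      fix y assume "y \<in> ?P"
      then have "\<bar>y \<bullet> v\<bar> \<le> 1" "\<bar>y \<bullet> w\<bar> \<le> 1" by auto
      moreover have "y = ?p + ((y \<bullet> v + 1) / 2) *\<^sub>R ((2 * k) *\<^sub>R v) + ((y \<bullet> w + 1) / 2) *\<^sub>R ((2 * l) *\<^sub>R w)"
      proof -
        have half: "((a + 1) / 2) * (2 * c) = c * a + c" for a c :: real by (simp add: field_simps)
        have "?p + ((y \<bullet> v + 1) / 2) *\<^sub>R ((2 * k) *\<^sub>R v) + ((y \<bullet> w + 1) / 2) *\<^sub>R ((2 * l) *\<^sub>R w)
            = (k * (y \<bullet> v)) *\<^sub>R v + (l * (y \<bullet> w)) *\<^sub>R w"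
          unfolding scaleR_scaleR half by (simp add: scaleR_add_left)
        then show ?thesis using x[of y] by simp
      qed
      moreover have "0 \<le> (y \<bullet> v + 1) / 2" "(y \<bullet> v + 1) / 2 \<le> 1"
        "0 \<le> (y \<bullet> w + 1) / 2" "(y \<bullet> w + 1) / 2 \<le> 1"
        using calculation(1,2) by (auto simp: abs_le_iff)
      ultimately show "y \<in> ?R" by blast
    qed
    show "?R \<subseteq> ?P"
    proof
      fix y assume "y \<in> ?R"
      then obtain s t where y: "y = ?p + s *\<^sub>R ((2 * k) *\<^sub>R v) + t *\<^sub>R ((2 * l) *\<^sub>R w)"
        and st: "0 \<le> s" "s \<le> 1" "0 \<le> t" "t \<le> 1" by blast
      have "y \<bullet> v = (2 * s - 1) * (k * (v \<bullet> v))" "y \<bullet> w = (2 * t - 1) * (l * (w \<bullet> w))"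
        by (simp_all add: y inner_diff_left inner_add_left o(1) wv algebra_simps)
      then have "y \<bullet> v = 2 * s - 1" "y \<bullet> w = 2 * t - 1" by (simp_all add: o)
      then show "y \<in> ?P" using st by (auto simp: abs_le_iff)
    qed
  qed
  moreover have "norm ((2 * k) *\<^sub>R v) = 2 * sqrt k" "norm ((2 * l) *\<^sub>R w) = 2 * sqrt l"
  proof -
    have "v \<bullet> v = 1 / k" "w \<bullet> w = 1 / l" using o kl by (simp_all add: field_simps)
    then have "norm v = 1 / sqrt k" "norm w = 1 / sqrt l"
      by (simp_all add: norm_eq_sqrt_inner real_sqrt_divide)
    moreover have sq: "2 * c / sqrt c = 2 * sqrt c" if "0 < c" for c :: real
      using that by (subst real_div_sqrt[of c, symmetric]) simp_all
    ultimately show "norm ((2 * k) *\<^sub>R v) = 2 * sqrt k" "norm ((2 * l) *\<^sub>R w) = 2 * sqrt l"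
      using kl sq[of k] sq[of l] by simp_all
  qed
  moreover have "orthogonal ((2 * k) *\<^sub>R v) ((2 * l) *\<^sub>R w)"
    using o(1) by (simp add: orthogonal_def)
  ultimately show "is_rectangle ?P (2 * sqrt k) (2 * sqrt l)"
    unfolding is_rectangle_def convex_hull_parallelogram by blast
  have "(cross2 v w)^2 * (k * l) = (k * (v \<bullet> v)) * (l * (w \<bullet> w))"
    by (simp add: cross2_square o(1))
  then show "(cross2 v w)^2 * (k * l) = 1" by (simp add: o)
qed

section \<open>The extremal problem for tight frames\<close>

lemma ceiling_half: "\<lceil>real n / 2\<rceil> = int ((n + 1) div 2)"
proof (cases "even n")
  case True
  then obtain m where "n = 2 * m" by (elim evenE)
  then show ?thesis by simp
next
  case False
  then obtain m where m: "n = 2 * m + 1" by (elim oddE)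
  have "\<lceil>real n / 2\<rceil> = int m + 1" unfolding m by (rule ceiling_unique) auto
  then show ?thesis using m by simp
qed

lemma floor_half: "\<lfloor>real n / 2\<rfloor> = int (n div 2)"
  using floor_divide_of_nat_eq[of n 2, where ?'a = real] by simp

lemma half_times_half: "((n + 1) div 2) * (n div 2) = n^2 div 4" for n :: nat
proof (cases "even n")
  case True
  then obtain m where m: "n = 2 * m" by (elim evenE)
  have "n^2 = 4 * m^2" by (simp add: m power2_eq_square)
  then have "n^2 div 4 = m^2" by simp
  then show ?thesis using m by (simp add: power2_eq_square)
next
  case False
  then obtain m where m: "n = 2 * m + 1" by (elim oddE)
  have "n^2 = 1 + 4 * (m^2 + m)" by (simp add: m power2_eq_square)
  then have "n^2 div 4 = m^2 + m" by simp
  then show ?thesis using m by (simp add: power2_eq_square)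
qed

text \<open>
  Sum and product determine the two numbers, and the two halves of \<open>n\<close> have this sum and product.
\<close>

lemma balanced_split:
  fixes k l n :: nat
  assumes "k + l = n" "k * l = n^2 div 4"
  shows "k = (n + 1) div 2 \<and> l = n div 2 \<or> l = (n + 1) div 2 \<and> k = n div 2"
proof -
  define c where "c = (n + 1) div 2"
  define d where "d = n div 2"
  have s: "int k + int l = int c + int d" using assms(1) by (simp add: c_def d_def)
  have p: "int k * int l = int c * int d"
    using assms(2) half_times_half[of n] by (metis c_def d_def of_nat_mult)
  have l: "int l = int c + int d - int k" using s by simp
  have "(int k - int c) * (int k - int d) = 0"
    using p unfolding l by (simp add: algebra_simps)
  then have "k = c \<or> k = d" by auto
  then show ?thesis using s by (auto simp: c_def d_def)
qed

context
  fixes u :: "'n::finite \<Rightarrow> real ^ 2" and P :: "(real ^ 2) set"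
  assumes frame: "\<And>x y. (\<Sum>i\<in>UNIV. (x \<bullet> u i) * (y \<bullet> u i)) = x \<bullet> y"
    and P_def: "P = {x. \<forall>i. \<bar>x \<bullet> u i\<bar> \<le> 1}" and P: "P \<in> lmeasurable"
    and n: "2 \<le> CARD('n)"
begin

lemma frame_section_Mantel:
  defines "y \<equiv> \<lambda>i j. (measure lebesgue P / 4 * cross2 (u i) (u j))^2"
  shows "measure lebesgue P \<le> 4 * sqrt (real (CARD('n)^2 div 4))"
    and "measure lebesgue P = 4 * sqrt (real (CARD('n)^2 div 4)) \<Longrightarrow>
      \<exists>i j. i \<noteq> j \<and> y i j = 1 \<and> (\<forall>k. k \<noteq> i \<longrightarrow> k \<noteq> j \<longrightarrow> y i k + y j k = 1)"
proof -
  let ?A = "measure lebesgue P"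
  have sym: "y i j = y j i" for i j
    by (simp add: y_def cross2_def power2_eq_square algebra_simps)
  have diag: "y i i = 0" for i by (simp add: y_def cross2_def)
  have red: "removable_pair y T \<or> removable_triple y T" if "2 \<le> card T" for T
    unfolding y_def using that P by (intro strips_removable) (auto simp: P_def)
  have sum: "(\<Sum>i\<in>UNIV. \<Sum>j\<in>UNIV. y i j) = 2 * (?A / 4)^2"
    unfolding y_def power_mult_distrib sum_distrib_left[symmetric] sum_cross2_square[OF frame]
    by (rule mult.commute)
  note M = weighted_Mantel[of "UNIV :: 'n set" y, OF finite sym diag red, unfolded sum]
  have A: "(?A / 4)^2 \<le> real (CARD('n)^2 div 4)" using M by auto
  then have "?A / 4 \<le> sqrt (real (CARD('n)^2 div 4))" by (rule real_le_rsqrt)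
  then show "?A \<le> 4 * sqrt (real (CARD('n)^2 div 4))" by simp
  assume "?A = 4 * sqrt (real (CARD('n)^2 div 4))"
  then have "(?A / 4)^2 = real (CARD('n)^2 div 4)" by simp
  then show "\<exists>i j. i \<noteq> j \<and> y i j = 1 \<and> (\<forall>k. k \<noteq> i \<longrightarrow> k \<noteq> j \<longrightarrow> y i k + y j k = 1)"
    using M n by auto
qed

text \<open>
  The pair from \<open>frame_section_Mantel\<close> has \<open>A * \<bar>v \<times> w\<bar> = 4\<close>, which leaves no room for a cut corner.
  For any other vector \<open>c1 v + c2 w\<close> one has \<open>c1\<^sup>2 + c2\<^sup>2 = 1\<close>; if both coefficients were nonzero, then
  \<open>\<bar>c1\<bar> + \<bar>c2\<bar> > 1\<close> and its strip would cut a corner. So only the directions \<open>\<plusminus>v\<close> and \<open>\<plusminus>w\<close>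
  occur, and only their multiplicities \<open>k\<close> and \<open>l\<close> matter.
\<close>

lemma frame_section_equality:
  assumes eq: "measure lebesgue P = 4 * sqrt (real (CARD('n)^2 div 4))"
  shows "is_rectangle P (2 * sqrt (real ((CARD('n) + 1) div 2))) (2 * sqrt (real (CARD('n) div 2)))"
proof -
  define A where "A = measure lebesgue P"
  obtain i j where ij: "i \<noteq> j" and yij: "(A / 4 * cross2 (u i) (u j))^2 = 1"
    and yk: "\<And>k. k \<noteq> i \<Longrightarrow> k \<noteq> j \<Longrightarrow>
      (A / 4 * cross2 (u i) (u k))^2 + (A / 4 * cross2 (u j) (u k))^2 = 1"
    using frame_section_Mantel(2)[OF eq] unfolding A_def by blast
  define v where "v = u i"
  define w where "w = u j"
  have D: "cross2 v w \<noteq> 0" using yij by (auto simp: v_def w_def)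
  have A0: "0 \<le> A" by (simp add: A_def)
  have AD: "\<bar>cross2 v w\<bar> * A = 4"
  proof -
    have "\<bar>A / 4 * cross2 v w\<bar> = 1" using yij by (simp add: v_def w_def abs_square_eq_1)
    then show ?thesis using A0 by (simp add: abs_mult field_simps)
  qed
  have strip: "\<bar>x \<bullet> u k\<bar> \<le> 1" if "x \<in> P" for x k using that by (simp add: P_def)
  have dir: "u k = v \<or> u k = - v \<or> u k = w \<or> u k = - w" for k
  proof (cases "k = i \<or> k = j")
    case False
    define c1 where "c1 = cross2 (u k) w / cross2 v w"
    define c2 where "c2 = cross2 v (u k) / cross2 v w"
    have uk: "u k = c1 *\<^sub>R v + c2 *\<^sub>R w"
      unfolding c1_def c2_def by (rule cross2_expand[OF D])
    have c: "c1^2 + c2^2 = 1"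
    proof -
      have "cross2 (u i) (u k) = cross2 v w * c2" "cross2 (u j) (u k) = - (cross2 v w * c1)"
        using D by (simp_all add: c1_def c2_def v_def w_def) (simp add: cross2_def)
      then have "(A / 4 * cross2 v w)^2 * (c1^2 + c2^2) = 1"
        using yk[of k] False by (simp add: power_mult_distrib power_divide algebra_simps)
      then show ?thesis using yij by (simp add: v_def w_def)
    qed
    have "c1 = 0 \<or> c2 = 0"
    proof (rule ccontr)
      assume nz: "\<not> (c1 = 0 \<or> c2 = 0)"
      have "\<bar>c1\<bar> \<le> 1" "\<bar>c2\<bar> \<le> 1"
        using c by (simp_all add: abs_square_le_1[symmetric]) (smt (verit) zero_le_power2)+
      moreover have big: "1 < \<bar>c1\<bar> + \<bar>c2\<bar>"
      proof -
        have "0 < \<bar>c1\<bar> * \<bar>c2\<bar>" using nz by simp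
        then have "1^2 < (\<bar>c1\<bar> + \<bar>c2\<bar>)^2" using c by (simp add: power2_sum)
        then show ?thesis by (rule power_less_imp_less_base) simp
      qed
      ultimately have "\<bar>cross2 v w\<bar> * measure lebesgue P
          \<le> 4 - (\<bar>c1\<bar> + \<bar>c2\<bar> - 1)^2 / (\<bar>c1\<bar> * \<bar>c2\<bar>)"
        using strip[of _ i] strip[of _ j] strip[of _ k]
        by (intro area_three_strips_le[OF P]) (auto simp: v_def w_def uk)
      moreover have "0 < (\<bar>c1\<bar> + \<bar>c2\<bar> - 1)^2 / (\<bar>c1\<bar> * \<bar>c2\<bar>)"
        using big nz by (intro divide_pos_pos) auto
      ultimately show False using AD unfolding A_def by linarith
    qed
    then consider "c1 = 0" "c2^2 = 1" | "c2 = 0" "c1^2 = 1" using c by auto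
    then show ?thesis
      by cases (auto simp: uk power2_eq_1_iff)
  qed (auto simp: v_def w_def)
  define K where "K = {k. u k = v \<or> u k = - v}"
  define k where "k = card K"
  define l where "l = card (- K)"
  have kl: "k + l = CARD('n)"
    using card_mono[of UNIV K]
    by (simp add: k_def l_def Compl_eq_Diff_UNIV card_Diff_subset)
  have vw: "v \<noteq> w" "v \<noteq> - w" "v \<noteq> 0" "w \<noteq> 0"
    using D by (auto simp: cross2_def)
  have "i \<in> K" "j \<in> - K" using vw by (auto simp: K_def v_def w_def)
  then have pos: "0 < real k" "0 < real l"
    by (auto simp: k_def l_def card_gt_0_iff)
  have two: "real k * (x \<bullet> v) * (y \<bullet> v) + real l * (x \<bullet> w) * (y \<bullet> w) = x \<bullet> y" for x y
  proof -
    have "(\<Sum>i\<in>UNIV. (x \<bullet> u i) * (y \<bullet> u i))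
        = (\<Sum>i\<in>K. (x \<bullet> u i) * (y \<bullet> u i)) + (\<Sum>i\<in>-K. (x \<bullet> u i) * (y \<bullet> u i))"
      using sum.subset_diff[of K UNIV "\<lambda>i. (x \<bullet> u i) * (y \<bullet> u i)"]
      by (simp add: Compl_eq_Diff_UNIV)
    also have "(\<Sum>i\<in>K. (x \<bullet> u i) * (y \<bullet> u i)) = (\<Sum>i\<in>K. (x \<bullet> v) * (y \<bullet> v))"
      by (rule sum.cong) (auto simp: K_def)
    also have "(\<Sum>i\<in>-K. (x \<bullet> u i) * (y \<bullet> u i)) = (\<Sum>i\<in>-K. (x \<bullet> w) * (y \<bullet> w))"
    proof (rule sum.cong)
      fix m assume "m \<in> - K"
      then have "u m = w \<or> u m = - w" using dir[of m] by (auto simp: K_def)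
      then show "(x \<bullet> u m) * (y \<bullet> u m) = (x \<bullet> w) * (y \<bullet> w)" by auto
    qed simp
    finally show ?thesis unfolding frame by (simp add: k_def l_def)
  qed
  have PP: "P = {x. \<bar>x \<bullet> v\<bar> \<le> 1 \<and> \<bar>x \<bullet> w\<bar> \<le> 1}"
  proof
    show "P \<subseteq> {x. \<bar>x \<bullet> v\<bar> \<le> 1 \<and> \<bar>x \<bullet> w\<bar> \<le> 1}"
      using strip by (auto simp: v_def w_def)
    show "{x. \<bar>x \<bullet> v\<bar> \<le> 1 \<and> \<bar>x \<bullet> w\<bar> \<le> 1} \<subseteq> P"
    proof
      fix x assume "x \<in> {x. \<bar>x \<bullet> v\<bar> \<le> 1 \<and> \<bar>x \<bullet> w\<bar> \<le> 1}"
      then have "\<bar>x \<bullet> u m\<bar> \<le> 1" for m using dir[of m] by auto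
      then show "x \<in> P" by (simp add: P_def)
    qed
  qed
  note R = two_strips_rectangle[OF two D pos]
  have "k * l = CARD('n)^2 div 4"
  proof -
    have "(A / 4)^2 * (cross2 v w)^2 = 1"
      using yij by (simp only: v_def w_def power_mult_distrib)
    moreover have "(A / 4)^2 = real (CARD('n)^2 div 4)" using eq by (simp add: A_def)
    ultimately have "real (CARD('n)^2 div 4) * (cross2 v w)^2 = real (k * l) * (cross2 v w)^2"
      using R(2) by (simp add: mult_ac)
    then have "real (CARD('n)^2 div 4) = real (k * l)" using D by (simp del: of_nat_mult)
    then show ?thesis by (simp only: of_nat_eq_iff)
  qed
  with balanced_split[OF kl] show ?thesis
    using R(1) unfolding PP[symmetric] by (auto intro: is_rectangle_commute)
qed

end

section \<open>Planar sections of the cube\<close>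

lemma plane_chart_section:
  assumes "plane_chart H f"
  shows "f -` (cube \<inter> H) = {x. \<forall>i. \<bar>x \<bullet> section_normal f i\<bar> \<le> 1}"
  using assms inner_section_normal[OF plane_chart_linear[OF assms]]
  by (auto simp: plane_chart_def cube_def abs_le_iff minus_le_iff)

lemma compact_cube_section:
  fixes H :: "(real ^ 'n) set"
  assumes "is_plane H"
  shows "compact (cube \<inter> H)"
proof -
  have box: "(cube :: (real ^ 'n) set) = cbox (\<chi> i. -1) (\<chi> i. 1)"
    by (auto simp: cube_def mem_box_cart)
  have "compact (cube :: (real ^ 'n) set)" unfolding box by (rule compact_cbox)
  moreover have "closed H" using assms by (simp add: is_plane_def closed_subspace)
  ultimately show ?thesis by (rule compact_Int_closed)
qed

lemma is_rectangle_chart_image: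
  assumes f: "plane_chart H f" and R: "is_rectangle R a b"
  shows "is_rectangle (f ` R) a b"
proof -
  have lin: "linear f" and nf: "\<And>x. norm (f x) = norm x" using f by (auto simp: plane_chart_def)
  obtain p v w where pvw: "orthogonal v w" "norm v = a" "norm w = b"
    and hull: "R = convex hull {p, p + v, p + v + w, p + w}"
    using R unfolding is_rectangle_def by blast
  have "f ` R = convex hull {f p, f p + f v, f p + f v + f w, f p + f w}"
    unfolding hull convex_hull_linear_image[OF lin] by (simp add: linear_add[OF lin])
  moreover have "orthogonal (f v) (f w)"
    using pvw(1) plane_chart_inner[OF f] by (simp add: orthogonal_def)
  ultimately show ?thesis
    unfolding is_rectangle_def using pvw nf by metis
qed

text \<open>
  The area of \<open>P\<close> in the chart carries the inequality and one direction of the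
  equivalence; the other direction is the area of a rectangle.
\<close>

lemma planar_cube_section:
  fixes H :: "(real ^ 'n::finite) set"
  assumes H: "is_plane H" and n: "2 \<le> CARD('n)"
  shows "area H (cube \<inter> H) \<le> 4 * sqrt (real (CARD('n)^2 div 4))"
    and "area H (cube \<inter> H) = 4 * sqrt (real (CARD('n)^2 div 4)) \<longleftrightarrow>
      is_rectangle (cube \<inter> H) (2 * sqrt (real ((CARD('n) + 1) div 2))) (2 * sqrt (real (CARD('n) div 2)))"
proof -
  obtain f where f: "plane_chart H f" using plane_chart_exists[OF H] by blast
  define P where "P = f -` (cube \<inter> H)"
  note c = compact_cube_section[OF H]
  have P: "P \<in> lmeasurable"
    unfolding P_def by (intro lmeasurable_compact plane_chart_vimage_compact[OF f] c)
  have PS: "P = {x. \<forall>i. \<bar>x \<bullet> section_normal f i\<bar> \<le> 1}"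
    unfolding P_def by (rule plane_chart_section[OF f])
  have area: "area H (cube \<inter> H) = measure lebesgue P"
    unfolding P_def by (rule area_eq[OF f c])
  note frame = tight_frame_section_normal[OF f]
  show "area H (cube \<inter> H) \<le> 4 * sqrt (real (CARD('n)^2 div 4))"
    unfolding area by (rule frame_section_Mantel(1)[OF frame PS P n])
  show "area H (cube \<inter> H) = 4 * sqrt (real (CARD('n)^2 div 4)) \<longleftrightarrow>
      is_rectangle (cube \<inter> H) (2 * sqrt (real ((CARD('n) + 1) div 2))) (2 * sqrt (real (CARD('n) div 2)))"
  proof
    assume "area H (cube \<inter> H) = 4 * sqrt (real (CARD('n)^2 div 4))"
    then have "is_rectangle P (2 * sqrt (real ((CARD('n) + 1) div 2))) (2 * sqrt (real (CARD('n) div 2)))"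
      unfolding area by (rule frame_section_equality[OF frame PS P n])
    moreover have "f ` P = cube \<inter> H" unfolding P_def using f by (auto simp: plane_chart_def)
    ultimately show "is_rectangle (cube \<inter> H) (2 * sqrt (real ((CARD('n) + 1) div 2)))
        (2 * sqrt (real (CARD('n) div 2)))"
      using is_rectangle_chart_image[OF f] by metis
  next
    assume "is_rectangle (cube \<inter> H) (2 * sqrt (real ((CARD('n) + 1) div 2)))
        (2 * sqrt (real (CARD('n) div 2)))"
    then have "area H (cube \<inter> H) = (2 * sqrt (real ((CARD('n) + 1) div 2))) * (2 * sqrt (real (CARD('n) div 2)))"
      using area_rectangle[OF H] by blast
    also have "\<dots> = 4 * sqrt (real (((CARD('n) + 1) div 2) * (CARD('n) div 2)))"
      by (simp add: real_sqrt_mult)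
    finally show "area H (cube \<inter> H) = 4 * sqrt (real (CARD('n)^2 div 4))"
      by (simp only: half_times_half)
  qed
qed

text \<open>
  On the span of the indicator vectors of \<open>K\<close> and of its complement the cube only restricts the two
  coefficients, each of them to \<open>[-1, 1]\<close>.
\<close>

lemma block_plane:
  fixes K :: "'n::finite set"
  assumes K: "K \<noteq> {}" "- K \<noteq> {}"
  shows "\<exists>H :: (real ^ 'n) set. is_plane H \<and>
    is_rectangle (cube \<inter> H) (2 * sqrt (real (card K))) (2 * sqrt (real (card (- K))))"
proof -
  define v :: "real ^ 'n" where "v = (\<chi> i. if i \<in> K then 1 else 0)"
  define w :: "real ^ 'n" where "w = (\<chi> i. if i \<in> K then 0 else 1)"
  have vw: "v \<bullet> w = 0" by (auto simp: v_def w_def inner_vec_def intro!: sum.neutral)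
  have "(\<Sum>i\<in>UNIV. v $ i * v $ i) = (\<Sum>i\<in>K. 1)"
    by (rule sum.mono_neutral_cong_right) (auto simp: v_def)
  then have vv: "v \<bullet> v = real (card K)" by (simp add: inner_vec_def)
  have "(\<Sum>i\<in>UNIV. w $ i * w $ i) = (\<Sum>i\<in>-K. 1)"
    by (rule sum.mono_neutral_cong_right) (auto simp: w_def)
  then have ww: "w \<bullet> w = real (card (- K))" by (simp add: inner_vec_def)
  have norms: "norm v = sqrt (real (card K))" "norm w = sqrt (real (card (- K)))"
    by (simp_all only: norm_eq_sqrt_inner vv ww)
  have nz: "v \<noteq> 0" "w \<noteq> 0"
    using K vv ww by (auto simp: card_eq_0_iff)
  have "v \<noteq> w" using vw nz by auto
  define H where "H = span {v, w}"
  have ind: "independent {v, w}"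
  proof (rule pairwise_orthogonal_independent)
    have "w \<bullet> v = 0" using vw by (simp only: inner_commute)
    then show "pairwise orthogonal {v, w}" using vw by (simp add: pairwise_def orthogonal_def)
  qed (use nz in simp)
  have "dim H = 2"
    unfolding H_def dim_span using \<open>v \<noteq> w\<close> by (simp add: dim_eq_card_independent[OF ind])
  then have plane: "is_plane H" by (simp add: is_plane_def H_def)
  have mem: "x \<in> H \<longleftrightarrow> (\<exists>a b. x = a *\<^sub>R v + b *\<^sub>R w)" for x
  proof
    assume "x \<in> H"
    then obtain a where "x - a *\<^sub>R v \<in> span {w}"
      unfolding H_def using span_breakdown_eq by (metis)
    then obtain b where "x - a *\<^sub>R v = b *\<^sub>R w" unfolding span_singleton by (elim rangeE)
    then have "x = a *\<^sub>R v + b *\<^sub>R w" by (simp only: diff_eq_eq add.commute[of "a *\<^sub>R v"])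
    then show "\<exists>a b. x = a *\<^sub>R v + b *\<^sub>R w" by (intro exI)
  next
    assume "\<exists>a b. x = a *\<^sub>R v + b *\<^sub>R w"
    then obtain a b where x: "x = a *\<^sub>R v + b *\<^sub>R w" by (elim exE)
    show "x \<in> H" unfolding H_def x by (intro span_add span_scale span_base) simp_all
  qed
  have cube: "a *\<^sub>R v + b *\<^sub>R w \<in> cube \<longleftrightarrow> \<bar>a\<bar> \<le> 1 \<and> \<bar>b\<bar> \<le> 1" for a b
  proof -
    have coord: "(a *\<^sub>R v + b *\<^sub>R w) $ i = (if i \<in> K then a else b)" for i
      by (simp add: v_def w_def)
    obtain i j where "i \<in> K" "j \<notin> K" using K by blast
    then have "(\<forall>i. -1 \<le> (if i \<in> K then a else b) \<and> (if i \<in> K then a else b) \<le> 1) \<longleftrightarrow>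
        (-1 \<le> a \<and> a \<le> 1) \<and> (-1 \<le> b \<and> b \<le> 1)" by metis
    then show ?thesis
      unfolding cube_def mem_Collect_eq coord by (simp only: abs_le_iff) (simp add: minus_le_iff conj_commute)
  qed
  let ?p = "- v - w"
  have "cube \<inter> H = {?p + s *\<^sub>R (2 *\<^sub>R v) + t *\<^sub>R (2 *\<^sub>R w) | s t. 0 \<le> s \<and> s \<le> 1 \<and> 0 \<le> t \<and> t \<le> 1}"
    (is "_ = ?R")
  proof
    show "cube \<inter> H \<subseteq> ?R"
    proof
      fix x assume "x \<in> cube \<inter> H"
      then obtain a b where x: "x = a *\<^sub>R v + b *\<^sub>R w" and ab: "\<bar>a\<bar> \<le> 1" "\<bar>b\<bar> \<le> 1"
        using mem[of x] cube by (metis IntE)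
      have "x = ?p + ((a + 1) / 2) *\<^sub>R (2 *\<^sub>R v) + ((b + 1) / 2) *\<^sub>R (2 *\<^sub>R w)"
      proof -
        have half: "((c + 1) / 2) * 2 = c + 1" for c :: real by simp
        show ?thesis unfolding scaleR_scaleR half by (simp add: x scaleR_add_left)
      qed
      moreover have "0 \<le> (a + 1) / 2" "(a + 1) / 2 \<le> 1" "0 \<le> (b + 1) / 2" "(b + 1) / 2 \<le> 1"
        using ab by (auto simp: abs_le_iff)
      ultimately show "x \<in> ?R" by blast
    qed
    show "?R \<subseteq> cube \<inter> H"
    proof
      fix x assume "x \<in> ?R"
      then obtain s t where x: "x = ?p + s *\<^sub>R (2 *\<^sub>R v) + t *\<^sub>R (2 *\<^sub>R w)"
        and st: "0 \<le> s" "s \<le> 1" "0 \<le> t" "t \<le> 1" by blast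
      have "x = (2 * s - 1) *\<^sub>R v + (2 * t - 1) *\<^sub>R w" by (simp add: x algebra_simps)
      moreover have "\<bar>2 * s - 1\<bar> \<le> 1" "\<bar>2 * t - 1\<bar> \<le> 1" using st by auto
      ultimately show "x \<in> cube \<inter> H" using mem[of x] cube by (metis IntI)
    qed
  qed
  then have "is_rectangle (cube \<inter> H) (2 * sqrt (real (card K))) (2 * sqrt (real (card (- K))))"
    unfolding is_rectangle_def convex_hull_parallelogram
    by - (rule exI[of _ ?p], rule exI[of _ "2 *\<^sub>R v"], rule exI[of _ "2 *\<^sub>R w"],
        simp add: orthogonal_def vw norms)
  with plane show ?thesis by (intro exI[of _ H] conjI)
qed

lemma ceiling_times_floor_half:
  "real_of_int (\<lceil>real n / 2\<rceil> * \<lfloor>real n / 2\<rfloor>) = real (n^2 div 4)"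
proof -
  have "\<lceil>real n / 2\<rceil> * \<lfloor>real n / 2\<rfloor> = int (((n + 1) div 2) * (n div 2))"
    unfolding ceiling_half floor_half by (simp only: of_nat_mult)
  then show ?thesis by (simp only: half_times_half of_int_of_nat_eq)
qed

theorem theorem1p3:
  fixes n :: nat
  assumes "CARD('n::finite) = n" and "n > 2"
  shows "(\<forall>H :: (real ^ 'n) set. is_plane H \<longrightarrow>
            area H (cube \<inter> H) \<le> 4 * sqrt (real_of_int (\<lceil>real n / 2\<rceil> * \<lfloor>real n / 2\<rfloor>)))
       \<and> (\<exists>H :: (real ^ 'n) set. is_plane H \<and>
            area H (cube \<inter> H) = 4 * sqrt (real_of_int (\<lceil>real n / 2\<rceil> * \<lfloor>real n / 2\<rfloor>)))
       \<and> (\<forall>H :: (real ^ 'n) set. is_plane H \<longrightarrow>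
            (area H (cube \<inter> H) = 4 * sqrt (real_of_int (\<lceil>real n / 2\<rceil> * \<lfloor>real n / 2\<rfloor>))
             \<longleftrightarrow> is_rectangle (cube \<inter> H) (2 * sqrt (real_of_int \<lceil>real n / 2\<rceil>))
                                          (2 * sqrt (real_of_int \<lfloor>real n / 2\<rfloor>))))"
proof -
  have n: "2 \<le> CARD('n)" using assms by simp
  have r: "real_of_int \<lceil>real n / 2\<rceil> = real ((n + 1) div 2)"
    "real_of_int \<lfloor>real n / 2\<rfloor> = real (n div 2)"
    unfolding ceiling_half floor_half by (simp_all only: of_int_of_nat_eq)
  note bound = planar_cube_section(1)[OF _ n, unfolded assms(1)]
    and equality = planar_cube_section(2)[OF _ n, unfolded assms(1)]
  obtain K :: "'n set" where cK: "card K = (n + 1) div 2"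
  proof -
    have "(n + 1) div 2 \<le> CARD('n)" using assms by simp
    then show ?thesis using obtain_subset_with_card_n that by metis
  qed
  have cK': "card (- K) = n div 2"
    using assms cK by (simp add: Compl_eq_Diff_UNIV card_Diff_subset)
  have "K \<noteq> {}" "- K \<noteq> {}"
  proof -
    have "0 < card K" "0 < card (- K)" unfolding cK cK' using assms(2) by simp_all
    then show "K \<noteq> {}" "- K \<noteq> {}" by auto
  qed
  then obtain H0 :: "(real ^ 'n) set" where H0: "is_plane H0"
    "is_rectangle (cube \<inter> H0) (2 * sqrt (real ((n + 1) div 2))) (2 * sqrt (real (n div 2)))"
    using block_plane[of K] unfolding cK cK' by blast
  show ?thesis
    unfolding ceiling_times_floor_half r
  proof (intro conjI allI impI)
    show "\<exists>H :: (real ^ 'n) set. is_plane H \<and> area H (cube \<inter> H) = 4 * sqrt (real (n^2 div 4))"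
      using H0 equality[OF H0(1)] by (intro exI[of _ H0] conjI) simp_all
  qed (use bound equality in simp_all)
qed


end
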